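(* Let $h$ be a densely defined multiplier of the CNP space $\mathcal H$ (on a set $X$, with kernel $k$), with Beurling pair $A,B$ (row multipliers from $\mathcal H\otimes\mathcal E$ to $\mathcal H$). Then for every representing pair $(a,b)$ for $h$, there exists a contractive multiplier $\Phi$ from $\mathcal H$ to $\mathcal H\otimes\mathcal E$ such that $a=A\Phi$ and $b=B\Phi$. Moreover, for every representing pair $(a,b)$ there are contractive containments $$\mathcal M(a)\subset\mathcal M(A)\quad\text{and}\quad \mathcal H(B)\subset\mathcal H(b).$$
   Context: A CNP kernel on a set $X$ is a kernel of the form $k(x,y)=\frac{1}{1-\langle u(x),u(y)\rangle}$ where $u:X\to \ell^2(I)$ is injective and $\|u(x)\|<1$ for all $x$. A CNP space on $X$ is the reproducing kernel Hilbert space $\mathcal H$ on $X$ with such a kernel. $\mathrm{Mult}(\mathcal H)$ is the algebra of functions $\varphi:X\to\mathbb C$ with $\varphi\mathcal H\subset\mathcal H$. A densely defined multiplier of $\mathcal H$ is a function $h:X\to\mathbb C$ for which $\mathrm{Dom}\,T=\{f\in\mathcal H: hf\in\mathcal H\}$ is dense in $\mathcal H$; $Tf=hf$ is then a closed densely defined operator with graph $G(T)=\{(f,Tf):f\in\mathrm{Dom}\,T\}\subset\mathcal H\oplus\mathcal H$. For a Hilbert space $\mathcal E$, $\mathcal H\otimes\mathcal E$ is identified with the $\mathcal E$-valued reproducing kernel Hilbert space on $X$ with kernel $k(x,y)I_{\mathcal E}$. A row multiplier $A:X\to\mathcal B(\mathcal E,\mathbb C)$ is a function for which $M_A:F\mapsto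 AF$ is bounded from $\mathcal H\otimes\mathcal E$ to $\mathcal H$; a (column) multiplier $\Phi:X\to\mathcal B(\mathbb C,\mathcal E)\cong\mathcal E$ from $\mathcal H$ to $\mathcal H\otimes\mathcal E$ is a function for which $M_\Phi:f\mapsto f\Phi$ is bounded from $\mathcal H$ to $\mathcal H\otimes\mathcal E$, and it is contractive if $\|M_\Phi\|\le1$. A Beurling pair for $h$ is a pair of row multipliers $A,B$ (for some Hilbert space $\mathcal E$) such that $F\mapsto(AF,BF)$ from $\mathcal H\otimes\mathcal E$ to $\mathcal H\oplus\mathcal H$ is a partial isometry with range exactly $G(T)$; such a pair exists, and one is fixed. A representing pair for $h$ is a pair of nonzero multipliers $a,b\in\mathrm{Mult}(\mathcal H)$ such that (i) $b=ah$ on $X$, and (ii) the column $f\mapsto(af,bf)$ from $\mathcal H$ to $\mathcal H\oplus\mathcal H$ is contractive. $\mathcal M(a)$, $\mathcal M(A)$, $\mathcal H(b)$, $\mathcal H(B)$ denote the reproducing kernel Hilbert spaces on $X$ with kernels $a(x)a(y)^*k(x,y)$, $A(x)A(y)^*k(x,y)$, $(1-b(x)b(y)^* )k(x,y)$, $(1-B(x)B(y)^* )k(x,y)$ respectively. "Contractive containment" means set inclusion with inclusion map of norm at most $1$. *)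

theory Defs
  imports "HOL-Analysis.Analysis"
begin

section \<open>Complex Hilbert spaces\<close>

text \<open>The inner product is linear in its first argument. Positivity and definiteness follow
  from \<open>norm_eq_sqrt_cinner\<close>, completeness is inherited from \<^class>\<open>banach\<close>.\<close>

class chilbert_space = banach +
  fixes scaleC :: "complex \<Rightarrow> 'a \<Rightarrow> 'a" (infixr "*\<^sub>C" 75)
    and cinner :: "'a \<Rightarrow> 'a \<Rightarrow> complex"
  assumes scaleC_of_real: "of_real r *\<^sub>C x = r *\<^sub>R x"
    and scaleC_add_right: "c *\<^sub>C (x + y) = c *\<^sub>C x + c *\<^sub>C y"
    and scaleC_add_left: "(c + d) *\<^sub>C x = c *\<^sub>C x + d *\<^sub>C x"
    and scaleC_scaleC: "c *\<^sub>C (d *\<^sub>C x) = (c * d) *\<^sub>C x"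
    and cinner_commute: "cinner x y = cnj (cinner y x)"
    and cinner_add_left: "cinner (x + y) z = cinner x z + cinner y z"
    and cinner_scaleC_left: "cinner (c *\<^sub>C x) y = c * cinner x y"
    and norm_eq_sqrt_cinner: "norm x = sqrt (Re (cinner x x))"

instantiation complex :: chilbert_space
begin

definition scaleC_complex :: "complex \<Rightarrow> complex \<Rightarrow> complex"
  where "scaleC_complex c z = c * z"

definition cinner_complex :: "complex \<Rightarrow> complex \<Rightarrow> complex"
  where "cinner_complex z w = z * cnj w"

instance
  by standard (auto simp: scaleC_complex_def cinner_complex_def algebra_simps
      scaleR_conv_of_real cmod_def power2_eq_square)

end

definition bounded_clinear :: "('a::chilbert_space \<Rightarrow> 'b::chilbert_space) \<Rightarrow> bool"
  where "bounded_clinear T \<longleftrightarrow>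
    (\<forall>v w. T (v + w) = T v + T w) \<and>
    (\<forall>c v. T (c *\<^sub>C v) = c *\<^sub>C T v) \<and>
    (\<exists>C. \<forall>v. norm (T v) \<le> C * norm v)"

definition cadjoint :: "('a::chilbert_space \<Rightarrow> 'b::chilbert_space) \<Rightarrow> 'b \<Rightarrow> 'a"
  where "cadjoint T = (THE S. \<forall>v w. cinner (T v) w = cinner v (S w))"

text \<open>\<open>row_gram A x y\<close> is the operator \<open>A(x) A(y)\<^sup>*\<close> on the complex numbers, identified with the
  scalar by which it multiplies.\<close>

definition row_gram :: "('x \<Rightarrow> 'e::chilbert_space \<Rightarrow> complex) \<Rightarrow> 'x \<Rightarrow> 'x \<Rightarrow> complex"
  where "row_gram A x y = A x (cadjoint (A y) 1)"


section \<open>Reproducing kernel Hilbert spaces\<close>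

text \<open>The set \<open>X\<close> is the type \<open>'x\<close>. A function space is a set of functions together with an
  inner product on it.\<close>

record ('x, 'e) fspace =
  elems :: "('x \<Rightarrow> 'e) set"
  ip :: "('x \<Rightarrow> 'e) \<Rightarrow> ('x \<Rightarrow> 'e) \<Rightarrow> complex"

definition fnorm :: "('x, 'e) fspace \<Rightarrow> ('x \<Rightarrow> 'e) \<Rightarrow> real"
  where "fnorm S f = sqrt (Re (ip S f f))"

definition hilbert_fspace :: "('x, 'e::chilbert_space) fspace \<Rightarrow> bool"
  where "hilbert_fspace S \<longleftrightarrow>
    (\<lambda>x. 0) \<in> elems S \<and>
    (\<forall>f\<in>elems S. \<forall>g\<in>elems S. (\<lambda>x. f x + g x) \<in> elems S) \<and>
    (\<forall>c. \<forall>f\<in>elems S. (\<lambda>x. c *\<^sub>C f x) \<in> elems S) \<and>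
    (\<forall>f\<in>elems S. \<forall>g\<in>elems S. ip S f g = cnj (ip S g f)) \<and>
    (\<forall>f\<in>elems S. \<forall>g\<in>elems S. \<forall>l\<in>elems S.
        ip S (\<lambda>x. f x + g x) l = ip S f l + ip S g l) \<and>
    (\<forall>c. \<forall>f\<in>elems S. \<forall>g\<in>elems S. ip S (\<lambda>x. c *\<^sub>C f x) g = c * ip S f g) \<and>
    (\<forall>f\<in>elems S. f \<noteq> (\<lambda>x. 0) \<longrightarrow> 0 < Re (ip S f f)) \<and>
    (\<forall>s :: nat \<Rightarrow> 'x \<Rightarrow> 'e.
        (\<forall>n. s n \<in> elems S) \<and>
        (\<forall>\<epsilon>>0. \<exists>N. \<forall>m\<ge>N. \<forall>n\<ge>N. fnorm S (\<lambda>x. s m x - s n x) < \<epsilon>) \<longrightarrow>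
        (\<exists>f\<in>elems S. (\<lambda>n. fnorm S (\<lambda>x. s n x - f x)) \<longlonglongrightarrow> 0))"

text \<open>\<open>has_kernel S k\<close> says that the operator-valued function \<open>k(x,y) I\<close> is the reproducing
  kernel of \<open>S\<close>; for scalar-valued functions this is the reproducing property of \<open>k\<close> itself.\<close>

definition has_kernel :: "('x, 'e::chilbert_space) fspace \<Rightarrow> ('x \<Rightarrow> 'x \<Rightarrow> complex) \<Rightarrow> bool"
  where "has_kernel S k \<longleftrightarrow>
    (\<forall>y v. (\<lambda>x. k x y *\<^sub>C v) \<in> elems S \<and>
           (\<forall>f\<in>elems S. ip S f (\<lambda>x. k x y *\<^sub>C v) = cinner (f y) v))"

text \<open>The third conjunct fixes the irrelevant values of the inner product off the space, so that
  the description is unique. At type \<open>('x, complex) fspace\<close> this is the scalar space \<open>\<H>\<close>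
  with kernel \<open>k\<close>, at type \<open>('x, 'e) fspace\<close> it is \<open>\<H> \<otimes> \<E>\<close>.\<close>

definition rkhs :: "('x \<Rightarrow> 'x \<Rightarrow> complex) \<Rightarrow> ('x, 'e::chilbert_space) fspace"
  where "rkhs k = (THE S. hilbert_fspace S \<and> has_kernel S k \<and>
    (\<forall>f g. f \<notin> elems S \<or> g \<notin> elems S \<longrightarrow> ip S f g = 0))"

definition contractively_contained ::
    "('x, 'e) fspace \<Rightarrow> ('x, 'e) fspace \<Rightarrow> bool"
  where "contractively_contained S S' \<longleftrightarrow>
    elems S \<subseteq> elems S' \<and> (\<forall>f\<in>elems S. fnorm S' f \<le> fnorm S f)"


section \<open>Complete Nevanlinna--Pick kernels\<close>

definition ell2 :: "('i \<Rightarrow> complex) set"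
  where "ell2 = {v. (\<lambda>i. (cmod (v i))\<^sup>2) summable_on UNIV}"

definition ell2_inner :: "('i \<Rightarrow> complex) \<Rightarrow> ('i \<Rightarrow> complex) \<Rightarrow> complex"
  where "ell2_inner v w = (\<Sum>\<^sub>\<infinity>i. v i * cnj (w i))"

definition ell2_norm :: "('i \<Rightarrow> complex) \<Rightarrow> real"
  where "ell2_norm v = sqrt (\<Sum>\<^sub>\<infinity>i. (cmod (v i))\<^sup>2)"

text \<open>The embedding \<open>u\<close> is a parameter because its index type \<open>'i\<close> cannot be quantified
  existentially.\<close>

definition cnp_kernel :: "('x \<Rightarrow> 'i \<Rightarrow> complex) \<Rightarrow> ('x \<Rightarrow> 'x \<Rightarrow> complex) \<Rightarrow> bool"
  where "cnp_kernel u k \<longleftrightarrow>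
    inj u \<and> (\<forall>x. u x \<in> ell2 \<and> ell2_norm (u x) < 1) \<and>
    (\<forall>x y. k x y = 1 / (1 - ell2_inner (u x) (u y)))"


section \<open>Multipliers\<close>

definition Mult :: "('x, complex) fspace \<Rightarrow> ('x \<Rightarrow> complex) set"
  where "Mult H = {\<phi>. \<forall>f\<in>elems H. (\<lambda>x. \<phi> x * f x) \<in> elems H}"

definition mult_dom :: "('x, complex) fspace \<Rightarrow> ('x \<Rightarrow> complex) \<Rightarrow> ('x \<Rightarrow> complex) set"
  where "mult_dom H h = {f \<in> elems H. (\<lambda>x. h x * f x) \<in> elems H}"

definition densely_defined_multiplier :: "('x, complex) fspace \<Rightarrow> ('x \<Rightarrow> complex) \<Rightarrow> bool"
  where "densely_defined_multiplier H h \<longleftrightarrow>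
    (\<forall>f\<in>elems H. \<forall>\<epsilon>>0. \<exists>g\<in>mult_dom H h. fnorm H (\<lambda>x. f x - g x) < \<epsilon>)"

definition mult_graph ::
    "('x, complex) fspace \<Rightarrow> ('x \<Rightarrow> complex) \<Rightarrow> (('x \<Rightarrow> complex) \<times> ('x \<Rightarrow> complex)) set"
  where "mult_graph H h = {(f, \<lambda>x. h x * f x) | f. f \<in> mult_dom H h}"

text \<open>The norm of \<open>\<H> \<oplus> \<H>\<close>.\<close>

definition sum_norm ::
    "('x, complex) fspace \<Rightarrow> ('x \<Rightarrow> complex) \<times> ('x \<Rightarrow> complex) \<Rightarrow> real"
  where "sum_norm H p = sqrt ((fnorm H (fst p))\<^sup>2 + (fnorm H (snd p))\<^sup>2)"

definition row_multiplier ::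
    "('x \<Rightarrow> 'x \<Rightarrow> complex) \<Rightarrow> ('x \<Rightarrow> 'e::chilbert_space \<Rightarrow> complex) \<Rightarrow> bool"
  where "row_multiplier k A \<longleftrightarrow>
    (let H = (rkhs k :: ('x, complex) fspace); HE = (rkhs k :: ('x, 'e) fspace) in
      (\<forall>x. bounded_clinear (A x)) \<and>
      (\<forall>F\<in>elems HE. (\<lambda>x. A x (F x)) \<in> elems H) \<and>
      (\<exists>C. \<forall>F\<in>elems HE. fnorm H (\<lambda>x. A x (F x)) \<le> C * fnorm HE F))"

definition contractive_column_multiplier ::
    "('x \<Rightarrow> 'x \<Rightarrow> complex) \<Rightarrow> ('x \<Rightarrow> 'e::chilbert_space) \<Rightarrow> bool"
  where "contractive_column_multiplier k \<Phi> \<longleftrightarrow>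
    (let H = (rkhs k :: ('x, complex) fspace); HE = (rkhs k :: ('x, 'e) fspace) in
      (\<forall>f\<in>elems H. (\<lambda>x. f x *\<^sub>C \<Phi> x) \<in> elems HE) \<and>
      (\<forall>f\<in>elems H. fnorm HE (\<lambda>x. f x *\<^sub>C \<Phi> x) \<le> fnorm H f))"

text \<open>A partial isometry is a map that is isometric on the orthogonal complement of its kernel.
  It is only applied to \<open>V\<close> that are linear with values in \<open>\<H> \<oplus> \<H>\<close>.\<close>

definition partial_isometry ::
    "('x, 'e) fspace \<Rightarrow> ('x, complex) fspace \<Rightarrow>
     (('x \<Rightarrow> 'e) \<Rightarrow> ('x \<Rightarrow> complex) \<times> ('x \<Rightarrow> complex)) \<Rightarrow> bool"
  where "partial_isometry HE H V \<longleftrightarrow>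
    (\<forall>F\<in>elems HE. (\<forall>G\<in>elems HE. V G = (\<lambda>x. 0, \<lambda>x. 0) \<longrightarrow> ip HE F G = 0) \<longrightarrow>
       sum_norm H (V F) = fnorm HE F)"

definition beurling_pair ::
    "('x \<Rightarrow> 'x \<Rightarrow> complex) \<Rightarrow> ('x \<Rightarrow> complex) \<Rightarrow>
     ('x \<Rightarrow> 'e::chilbert_space \<Rightarrow> complex) \<Rightarrow> ('x \<Rightarrow> 'e \<Rightarrow> complex) \<Rightarrow> bool"
  where "beurling_pair k h A B \<longleftrightarrow>
    (let H = (rkhs k :: ('x, complex) fspace); HE = (rkhs k :: ('x, 'e) fspace);
         V = (\<lambda>F. (\<lambda>x. A x (F x), \<lambda>x. B x (F x))) in
      row_multiplier k A \<and> row_multiplier k B \<and>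
      partial_isometry HE H V \<and> V ` elems HE = mult_graph H h)"

definition representing_pair ::
    "('x \<Rightarrow> 'x \<Rightarrow> complex) \<Rightarrow> ('x \<Rightarrow> complex) \<Rightarrow>
     ('x \<Rightarrow> complex) \<Rightarrow> ('x \<Rightarrow> complex) \<Rightarrow> bool"
  where "representing_pair k h a b \<longleftrightarrow>
    (let H = (rkhs k :: ('x, complex) fspace) in
      a \<in> Mult H \<and> b \<in> Mult H \<and> a \<noteq> (\<lambda>x. 0) \<and> b \<noteq> (\<lambda>x. 0) \<and>
      (\<forall>x. b x = a x * h x) \<and>
      (\<forall>f\<in>elems H. sum_norm H (\<lambda>x. a x * f x, \<lambda>x. b x * f x) \<le> fnorm H f))"


section \<open>Range spaces and de Branges--Rovnyak spaces\<close>

definition M_space :: "('x \<Rightarrow> 'x \<Rightarrow> complex) \<Rightarrow> ('x \<Rightarrow> complex) \<Rightarrow> ('x, complex) fspace"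
  where "M_space k a = rkhs (\<lambda>x y. a x * cnj (a y) * k x y)"

definition M_space_row ::
    "('x \<Rightarrow> 'x \<Rightarrow> complex) \<Rightarrow> ('x \<Rightarrow> 'e::chilbert_space \<Rightarrow> complex) \<Rightarrow> ('x, complex) fspace"
  where "M_space_row k A = rkhs (\<lambda>x y. row_gram A x y * k x y)"

definition H_space :: "('x \<Rightarrow> 'x \<Rightarrow> complex) \<Rightarrow> ('x \<Rightarrow> complex) \<Rightarrow> ('x, complex) fspace"
  where "H_space k b = rkhs (\<lambda>x y. (1 - b x * cnj (b y)) * k x y)"

definition H_space_row ::
    "('x \<Rightarrow> 'x \<Rightarrow> complex) \<Rightarrow> ('x \<Rightarrow> 'e::chilbert_space \<Rightarrow> complex) \<Rightarrow> ('x, complex) fspace"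
  where "H_space_row k B = rkhs (\<lambda>x y. (1 - row_gram B x y) * k x y)"

end

theory Submission
  imports Defs
begin

text \<open>Write \<open>V\<close> for the partial isometry \<open>F \<mapsto> (AF, BF)\<close> and \<open>c\<close> for the column \<open>f \<mapsto> (af, bf)\<close>. Since \<open>c\<close>
  is contractive with range in \<open>G(T) = ran V\<close>, one has \<open>c c\<^sup>* \<le> V V\<^sup>*\<close>, so that
  \<open>k\<^sub>x \<otimes> A(x)\<^sup>* \<mapsto> cnj a(x) k\<^sub>x\<close>, \<open>k\<^sub>x \<otimes> B(x)\<^sup>* \<mapsto> cnj b(x) k\<^sub>x\<close> is contractive; this positivity
  already yields both containments. A contraction that sends every vector \<open>k\<^sub>x \<otimes> e\<close> of its domain
  to a multiple of \<open>k\<^sub>x\<close> can be extended to one further vector \<open>k\<^sub>z \<otimes> e\<close> by the complete Pick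
  property, hence by Zorn's lemma to all of them, and the resulting map is the adjoint of
  multiplication by some \<open>\<Phi>\<close>, which solves \<open>A \<Phi> = a\<close> and \<open>B \<Phi> = b\<close>.\<close>

subsection \<open>Elementary Hilbert space facts\<close>

text \<open>Neither an adjoint of V nor a completion is ever formed. \<open>rkhs\<close> is a
  definite description, so nothing about it is available before existence and uniqueness are shown;
  both rest on one characterization: f lies in the space with norm at most M iff its pairing with
  every finite combination of kernel functions is at most M times the Gram seminorm of that
  combination. Claims thus become inequalities on finite lists, where null vectors do no harm. The
  operator inequality behind the contraction holds because V V^* is the projection onto G(T). It is
  obtained by lifting (aq, bq), for a combination q of kernel functions, to some F orthogonal to ker
  V, so that F has norm at most that of q, and pairing F with the vector that is to be sent to q.
  The Pick extension adds a single vector at a time and not a whole fibre: the unknown is then one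
  scalar t, and a norm-preserving extension of a scalar functional suffices. Linearity in e is not
  imposed along the way; positivity forces it afterwards.\<close>

lemma scaleC_zero_left [simp]: "0 *\<^sub>C (x::'e::chilbert_space) = 0"
  using scaleC_of_real[of 0 x] by simp

lemma scaleC_one [simp]: "1 *\<^sub>C (x::'e::chilbert_space) = x"
  using scaleC_of_real[of 1 x] by simp

lemma scaleC_minus_one: "(-1) *\<^sub>C (x::'e::chilbert_space) = - x"
  using scaleC_of_real[of "-1" x] by simp

lemma scaleC_zero_right [simp]: "c *\<^sub>C (0::'e::chilbert_space) = 0"
  using scaleC_add_right[of c 0 "0::'e"] by simp

lemma cinner_zero_left [simp]: "cinner 0 (x::'e::chilbert_space) = 0"
  using cinner_add_left[of 0 0 x] by simp

lemma cinner_zero_right [simp]: "cinner (x::'e::chilbert_space) 0 = 0"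
  using cinner_commute[of x 0] by simp

lemma cinner_add_right: "cinner (x::'e::chilbert_space) (y + z) = cinner x y + cinner x z"
  by (metis cinner_add_left cinner_commute complex_cnj_add)

lemma cinner_scaleC_right: "cinner (x::'e::chilbert_space) (c *\<^sub>C y) = cnj c * cinner x y"
  by (metis cinner_commute cinner_scaleC_left complex_cnj_mult)

lemma cinner_diff_left: "cinner (x - y) (z::'e::chilbert_space) = cinner x z - cinner y z"
  using cinner_add_left[of "x - y" y z] by (simp add: algebra_simps)

lemma cinner_diff_right: "cinner z (x - y) = cinner z x - cinner z (y::'e::chilbert_space)"
  using cinner_add_right[of z "x - y" y] by (simp add: algebra_simps)

lemma Re_cinner_self: "Re (cinner x x) = (norm (x::'e::chilbert_space))\<^sup>2"
proof -
  have "0 \<le> sqrt (Re (cinner x x))"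
    by (metis norm_eq_sqrt_cinner norm_ge_zero)
  then show ?thesis
    by (simp add: norm_eq_sqrt_cinner)
qed

lemma cinner_self: "cinner x x = of_real ((norm (x::'e::chilbert_space))\<^sup>2)"
proof -
  have "Im (cinner x x) = 0"
    using arg_cong[OF cinner_commute[of x x], of Im] by simp
  then show ?thesis
    by (simp add: complex_eq_iff Re_cinner_self)
qed

lemma cinner_complex: "cinner z w = z * cnj w" for z w :: complex
  by (simp add: cinner_complex_def)

lemma scaleC_complex: "z *\<^sub>C w = z * w" for z w :: complex
  by (simp add: scaleC_complex_def)

lemma cinner_eq_zeroD: "(\<And>v. cinner (x::'e::chilbert_space) v = 0) \<Longrightarrow> x = 0"
  using Re_cinner_self[of x] by simp

text \<open>The discriminant argument behind Cauchy-Schwarz, with a free right-hand side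
  \<open>e\<close> so that it also applies to points that only nearly maximize a quadratic
  functional.\<close>

lemma quadratic_bound:
  fixes w :: complex
  assumes "\<And>z. 2 * Re (cnj z * w) - (cmod z)\<^sup>2 * q \<le> e" and "0 \<le> q"
  shows "(cmod w)\<^sup>2 \<le> e * q"
proof -
  \<comment> \<open>Only z = t w with t real is tested; the phase of w makes the linear term
    real.\<close>
  have 1: "2 * t * (cmod w)\<^sup>2 - t\<^sup>2 * (cmod w)\<^sup>2 * q \<le> e" for t :: real
  proof -
    have "Re (cnj (of_real t * w) * w) = t * (cmod w)\<^sup>2"
      by (simp add: cmod_power2) (simp add: power2_eq_square algebra_simps)
    moreover have "(cmod (of_real t * w))\<^sup>2 = t\<^sup>2 * (cmod w)\<^sup>2"
      by (simp add: norm_mult power_mult_distrib)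
    ultimately show ?thesis
      using assms(1)[of "of_real t * w"] by simp
  qed
  show ?thesis
  proof (cases "q = 0")
    case True
    have "w = 0"
    proof (rule ccontr)
      assume "w \<noteq> 0"
      \<comment> \<open>With q = 0 the hypothesis is linear in t; this t pushes the left side to e +
        1.\<close>
      then have "2 * ((e + 1) / (2 * (cmod w)\<^sup>2)) * (cmod w)\<^sup>2 = e + 1"
        by (simp add: field_simps)
      then show False
        using 1[of "(e + 1) / (2 * (cmod w)\<^sup>2)"] True by simp
    qed
    then show ?thesis
      using True by simp
  next
    case False
    then have "q > 0"
      using assms(2) by simp
    then have "(cmod w)\<^sup>2 / q \<le> e"
      using 1[of "1 / q"] by (simp add: power2_eq_square field_simps)
    then show ?thesis
      using \<open>q > 0\<close> by (simp add: field_simps)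
  qed
qed

text \<open>The rate 1/(n+1) is the error of the n-th approximant in \<open>riesz_approx\<close>,
  the source of the sequences to which this is applied.\<close>

lemma Cauchy_if_inverse_bound:
  fixes X :: "nat \<Rightarrow> 'm::metric_space"
  assumes "\<And>m n. dist (X m) (X n) \<le> K * (inverse (real (Suc m)) + inverse (real (Suc n)))"
  shows "Cauchy X"
proof (rule metric_CauchyI)
  fix e :: real assume "0 < e"
  have "(\<lambda>n. \<bar>K\<bar> * inverse (real (Suc n))) \<longlonglongrightarrow> 0"
    using tendsto_mult_left[OF LIMSEQ_inverse_real_of_nat, of "\<bar>K\<bar>"] by simp
  then obtain N where N: "\<And>n. n \<ge> N \<Longrightarrow> \<bar>K\<bar> * inverse (real (Suc n)) < e / 2"
    using order_tendstoD(2)[of _ 0 sequentially "e / 2"] \<open>0 < e\<close>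
    unfolding eventually_sequentially by (metis half_gt_zero)
  have "dist (X m) (X n) < e" if "m \<ge> N" "n \<ge> N" for m n
  proof -
    have "K * (inverse (real (Suc m)) + inverse (real (Suc n)))
        \<le> \<bar>K\<bar> * (inverse (real (Suc m)) + inverse (real (Suc n)))"
      by (intro mult_right_mono) auto
    then show ?thesis
      using assms[of m n] N[OF that(1)] N[OF that(2)] by (simp add: distrib_left)
  qed
  then show "\<exists>M. \<forall>m\<ge>M. \<forall>n\<ge>M. dist (X m) (X n) < e"
    by blast
qed

subsection \<open>Semi-inner products\<close>

text \<open>No group axioms are imposed on the addition, so that finite formal combinations,
  represented as lists, are an instance.\<close>

locale semi_inner =
  fixes C :: "'a set" and add :: "'a \<Rightarrow> 'a \<Rightarrow> 'a" and sc :: "complex \<Rightarrow> 'a \<Rightarrow> 'a"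
    and ip :: "'a \<Rightarrow> 'a \<Rightarrow> complex"
  assumes nonempty: "C \<noteq> {}"
    and add_closed: "f \<in> C \<Longrightarrow> g \<in> C \<Longrightarrow> add f g \<in> C"
    and sc_closed: "f \<in> C \<Longrightarrow> sc z f \<in> C"
    and ip_add_left: "f \<in> C \<Longrightarrow> g \<in> C \<Longrightarrow> l \<in> C \<Longrightarrow> ip (add f g) l = ip f l + ip g l"
    and ip_sc_left: "f \<in> C \<Longrightarrow> g \<in> C \<Longrightarrow> ip (sc z f) g = z * ip f g"
    and ip_commute: "f \<in> C \<Longrightarrow> g \<in> C \<Longrightarrow> ip f g = cnj (ip g f)"
    and ip_nonneg: "f \<in> C \<Longrightarrow> 0 \<le> Re (ip f f)"
begin

definition Q :: "'a \<Rightarrow> real" where "Q f = Re (ip f f)"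

definition sub :: "'a \<Rightarrow> 'a \<Rightarrow> 'a" where "sub f g = add f (sc (-1) g)"

lemma sub_closed: "f \<in> C \<Longrightarrow> g \<in> C \<Longrightarrow> sub f g \<in> C"
  by (simp add: sub_def add_closed sc_closed)

lemma Q_nonneg: "f \<in> C \<Longrightarrow> 0 \<le> Q f"
  by (simp add: Q_def ip_nonneg)

lemma ip_self: "f \<in> C \<Longrightarrow> ip f f = of_real (Q f)"
  using ip_commute[of f f] by (auto simp: Q_def complex_eq_iff)

lemma ip_add_right: "f \<in> C \<Longrightarrow> g \<in> C \<Longrightarrow> l \<in> C \<Longrightarrow> ip l (add f g) = ip l f + ip l g"
  by (metis add_closed complex_cnj_add ip_add_left ip_commute)

lemma ip_sc_right: "f \<in> C \<Longrightarrow> g \<in> C \<Longrightarrow> ip f (sc z g) = cnj z * ip f g"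
  by (metis complex_cnj_mult ip_commute ip_sc_left sc_closed)

lemma ip_sub_left: "f \<in> C \<Longrightarrow> g \<in> C \<Longrightarrow> l \<in> C \<Longrightarrow> ip (sub f g) l = ip f l - ip g l"
  by (simp add: sub_def ip_add_left ip_sc_left sc_closed)

lemma Q_add_sc:
  assumes "f \<in> C" "g \<in> C"
  shows "Q (add f (sc z g)) = Q f + (cmod z)\<^sup>2 * Q g + 2 * Re (cnj z * ip f g)"
proof -
  have "ip (add f (sc z g)) (add f (sc z g))
      = ip f f + z * cnj z * ip g g + (cnj z * ip f g + cnj (cnj z * ip f g))"
    using assms ip_commute[of g f]
    by (simp add: ip_add_left ip_add_right ip_sc_left ip_sc_right add_closed sc_closed algebra_simps)
  also have "\<dots> = of_real (Q f + (cmod z)\<^sup>2 * Q g) + (cnj z * ip f g + cnj (cnj z * ip f g))"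
    using assms by (simp add: ip_self complex_norm_square[symmetric])
  finally show ?thesis
    by (simp add: Q_def complex_eq_iff)
qed

lemma cauchy_schwarz_sq:
  assumes "f \<in> C" "g \<in> C"
  shows "(cmod (ip f g))\<^sup>2 \<le> Q f * Q g"
proof (rule quadratic_bound)
  fix z
  show "2 * Re (cnj z * ip f g) - (cmod z)\<^sup>2 * Q g \<le> Q f"
    using Q_add_sc[OF assms, of "- z"] Q_nonneg[of "add f (sc (- z) g)"] assms
    by (simp add: add_closed sc_closed)
qed (use assms Q_nonneg in auto)

lemma cauchy_schwarz:
  assumes "f \<in> C" "g \<in> C"
  shows "cmod (ip f g) \<le> sqrt (Q f) * sqrt (Q g)"
  using real_le_rsqrt[OF cauchy_schwarz_sq[OF assms]] by (simp add: real_sqrt_mult)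

text \<open>The seminorm is attained as a dual norm at \<open>e = f\<close>. This bounds vectors
  that are known only through their inner products.\<close>

lemma Q_le_if_bounded:
  assumes "f \<in> C" "0 \<le> M" and "\<And>e. e \<in> C \<Longrightarrow> cmod (ip f e) \<le> M * sqrt (Q e)"
  shows "sqrt (Q f) \<le> M"
proof -
  have "sqrt (Q f) * sqrt (Q f) \<le> M * sqrt (Q f)"
    using assms(3)[of f] assms(1) by (simp add: ip_self Q_nonneg)
  then show ?thesis
    using assms(2) Q_nonneg[OF assms(1)] by (metis mult_right_le_imp_le order_le_less real_sqrt_ge_zero)
qed

lemma subspace_semi_inner:
  assumes "D \<subseteq> C" "D \<noteq> {}" "\<And>f g. f \<in> D \<Longrightarrow> g \<in> D \<Longrightarrow> add f g \<in> D"
    "\<And>f z. f \<in> D \<Longrightarrow> sc z f \<in> D"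
  shows "semi_inner D add sc ip"
proof -
  have inC: "f \<in> C" if "f \<in> D" for f
    using that assms(1) by blast
  show ?thesis
  proof
    show "ip f g = cnj (ip g f)" if "f \<in> D" "g \<in> D" for f g
      using inC[OF that(1)] inC[OF that(2)] by (rule ip_commute)
  qed (simp_all add: assms inC ip_add_left ip_sc_left ip_nonneg)
qed

text \<open>The Riesz representation theorem without completeness: almost maximizing
  \<open>2 Re \<phi>(c) - \<parallel>c\<parallel>\<^sup>2\<close> represents \<open>\<phi>\<close> up to a small error in the dual norm.\<close>

lemma riesz_approx:
  assumes \<phi>_add: "\<And>f g. f \<in> C \<Longrightarrow> g \<in> C \<Longrightarrow> \<phi> (add f g) = \<phi> f + \<phi> g"
    and \<phi>_sc: "\<And>f z. f \<in> C \<Longrightarrow> \<phi> (sc z f) = cnj z * \<phi> f"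
    and bound: "\<And>f. f \<in> C \<Longrightarrow> cmod (\<phi> f) \<le> M * sqrt (Q f)"
  shows "\<exists>c. \<forall>n. c n \<in> C \<and>
    (\<forall>e\<in>C. cmod (\<phi> e - ip (c n) e) \<le> inverse (real (Suc n)) * sqrt (Q e))"
proof -
  define J where "J c = 2 * Re (\<phi> c) - Q c" for c
  have J_le: "J c \<le> M\<^sup>2" if "c \<in> C" for c
  proof -
    have "Re (\<phi> c) \<le> M * sqrt (Q c)"
      using bound[OF that] complex_Re_le_cmod[of "\<phi> c"] by linarith
    moreover have "0 \<le> (M - sqrt (Q c))\<^sup>2"
      by simp
    ultimately show ?thesis
      using Q_nonneg[OF that] by (simp add: J_def power2_diff)
  qed
  have bdd: "bdd_above (J ` C)"
    using J_le by (meson bdd_above.I2)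
  have "\<exists>c\<in>C. \<forall>e\<in>C. cmod (\<phi> e - ip c e) \<le> \<epsilon> * sqrt (Q e)" if "\<epsilon> > 0" for \<epsilon> :: real
  proof -
    \<comment> \<open>A defect of \<open>\<epsilon>\<^sup>2\<close> in the supremum becomes, through
      \<open>quadratic_bound\<close>, an error of \<epsilon> in the dual norm.\<close>
    have "Sup (J ` C) - \<epsilon>\<^sup>2 < Sup (J ` C)"
      using that by simp
    then obtain c where c: "c \<in> C" "Sup (J ` C) - \<epsilon>\<^sup>2 < J c"
      using less_cSup_iff[of "J ` C"] nonempty bdd by auto
    have "cmod (\<phi> e - ip c e) \<le> \<epsilon> * sqrt (Q e)" if e: "e \<in> C" for e
    proof -
      have "(cmod (\<phi> e - ip c e))\<^sup>2 \<le> \<epsilon>\<^sup>2 * Q e"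
      proof (rule quadratic_bound)
        fix z
        have "J (add c (sc z e)) \<le> Sup (J ` C)"
          using bdd c e by (intro cSup_upper) (auto simp: add_closed sc_closed)
        moreover have "J (add c (sc z e)) = J c + 2 * Re (cnj z * (\<phi> e - ip c e)) - (cmod z)\<^sup>2 * Q e"
          using c e by (simp add: J_def Q_add_sc \<phi>_add \<phi>_sc sc_closed algebra_simps)
        ultimately show "2 * Re (cnj z * (\<phi> e - ip c e)) - (cmod z)\<^sup>2 * Q e \<le> \<epsilon>\<^sup>2"
          using c(2) by simp
      qed (use e Q_nonneg in auto)
      then show ?thesis
        using real_le_rsqrt[of _ "\<epsilon>\<^sup>2 * Q e"] \<open>\<epsilon> > 0\<close> by (simp add: real_sqrt_mult)
    qed
    then show ?thesis
      using c by auto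
  qed
  then have "\<exists>c\<in>C. \<forall>e\<in>C. cmod (\<phi> e - ip c e) \<le> inverse (real (Suc n)) * sqrt (Q e)" for n
    by simp
  then show ?thesis
    by metis
qed

context
  fixes \<phi> :: "'a \<Rightarrow> complex" and c :: "nat \<Rightarrow> 'a"
  assumes c: "\<And>n. c n \<in> C"
    and approx: "\<And>n e. e \<in> C \<Longrightarrow> cmod (\<phi> e - ip (c n) e) \<le> inverse (real (Suc n)) * sqrt (Q e)"
begin

text \<open>Both approximants represent the same functional up to their errors, so their difference
  has dual norm at most the sum of the errors.\<close>

lemma approx_cauchy: "sqrt (Q (sub (c m) (c n))) \<le> inverse (real (Suc m)) + inverse (real (Suc n))"
proof (rule Q_le_if_bounded)
  fix e assume e: "e \<in> C"
  have "ip (sub (c m) (c n)) e = (\<phi> e - ip (c n) e) - (\<phi> e - ip (c m) e)"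
    using c e by (simp add: ip_sub_left)
  then have "cmod (ip (sub (c m) (c n)) e) \<le> cmod (\<phi> e - ip (c n) e) + cmod (\<phi> e - ip (c m) e)"
    by (metis norm_triangle_ineq4)
  also have "\<dots> \<le> (inverse (real (Suc m)) + inverse (real (Suc n))) * sqrt (Q e)"
    using approx[OF e, of n] approx[OF e, of m] by (simp add: algebra_simps)
  finally show "cmod (ip (sub (c m) (c n)) e)
      \<le> (inverse (real (Suc m)) + inverse (real (Suc n))) * sqrt (Q e)" .
qed (use c sub_closed in auto)

lemma approx_Q_le:
  assumes "0 \<le> M" "\<And>e. e \<in> C \<Longrightarrow> cmod (\<phi> e) \<le> M * sqrt (Q e)"
  shows "sqrt (Q (c n)) \<le> M + inverse (real (Suc n))"
proof (rule Q_le_if_bounded)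
  fix e assume e: "e \<in> C"
  have "cmod (ip (c n) e) \<le> cmod (\<phi> e) + cmod (\<phi> e - ip (c n) e)"
    by (metis norm_minus_commute norm_triangle_sub)
  also have "\<dots> \<le> (M + inverse (real (Suc n))) * sqrt (Q e)"
    using approx[OF e, of n] assms(2)[OF e] by (simp add: algebra_simps)
  finally show "cmod (ip (c n) e) \<le> (M + inverse (real (Suc n))) * sqrt (Q e)" .
qed (use assms c in auto)

lemma approx_tendsto:
  assumes "e \<in> C"
  shows "(\<lambda>n. ip (c n) e) \<longlonglongrightarrow> \<phi> e"
proof -
  have "(\<lambda>n. ip (c n) e - \<phi> e) \<longlonglongrightarrow> 0"
  proof (rule Lim_null_comparison)
    show "\<forall>\<^sub>F n in sequentially. norm (ip (c n) e - \<phi> e) \<le> inverse (real (Suc n)) * sqrt (Q e)"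
      using approx[OF assms] by (simp add: norm_minus_commute)
    show "(\<lambda>n. inverse (real (Suc n)) * sqrt (Q e)) \<longlonglongrightarrow> 0"
      using tendsto_mult_right[OF LIMSEQ_inverse_real_of_nat, of "sqrt (Q e)"] by simp
  qed
  then show ?thesis
    by (simp add: LIM_zero_iff)
qed

end

text \<open>Norm-preserving extension by composing \<open>l\<close> with the orthogonal projection
  onto \<open>D\<close>. The projection of \<open>f0\<close> need not exist in \<open>D\<close>; its
  approximants \<open>m n\<close> do, and \<tau> is the limit of \<open>l (m n)\<close>.\<close>

lemma functional_extension:
  assumes D: "D \<subseteq> C" "D \<noteq> {}" "\<And>f g. f \<in> D \<Longrightarrow> g \<in> D \<Longrightarrow> add f g \<in> D"
      "\<And>f z. f \<in> D \<Longrightarrow> sc z f \<in> D"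
    and f0: "f0 \<in> C"
    and l_add: "\<And>f g. f \<in> D \<Longrightarrow> g \<in> D \<Longrightarrow> l (add f g) = l f + l g"
    and l_sc: "\<And>f z. f \<in> D \<Longrightarrow> l (sc z f) = z * l f"
    and l_le: "\<And>f. f \<in> D \<Longrightarrow> cmod (l f) \<le> sqrt (Q f)"
  shows "\<exists>\<tau>. \<forall>\<alpha>. \<forall>u\<in>D. cmod (\<alpha> * \<tau> + l u) \<le> sqrt (Q (add (sc \<alpha> f0) u))"
proof -
  interpret D: semi_inner D add sc ip
    using D by (rule subspace_semi_inner)
  have inC: "u \<in> D \<Longrightarrow> u \<in> C" for u
    using D(1) by auto
  have "\<exists>m. \<forall>n. m n \<in> D \<and>
      (\<forall>e\<in>D. cmod (ip f0 e - ip (m n) e) \<le> inverse (real (Suc n)) * sqrt (Q e))"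
    by (rule D.riesz_approx[of "ip f0" "sqrt (Q f0)"])
      (simp_all add: inC f0 ip_add_right ip_sc_right cauchy_schwarz)
  then obtain m where m: "\<And>n. m n \<in> D" and approx: "\<And>n e. e \<in> D \<Longrightarrow>
      cmod (ip f0 e - ip (m n) e) \<le> inverse (real (Suc n)) * sqrt (Q e)"
    by blast
  have "Cauchy (\<lambda>n. l (m n))"
  proof (rule Cauchy_if_inverse_bound[where K = 1])
    fix i j
    have "l (m i) - l (m j) = l (sub (m i) (m j))"
      using m by (simp add: sub_def l_add l_sc D.sc_closed)
    then show "dist (l (m i)) (l (m j)) \<le> 1 * (inverse (real (Suc i)) + inverse (real (Suc j)))"
      using order_trans[OF l_le[OF D.sub_closed[OF m m]] D.approx_cauchy[of m, OF m approx]]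
      by (simp add: dist_norm del: of_nat_Suc)
  qed
  then obtain \<tau> where \<tau>: "(\<lambda>n. l (m n)) \<longlonglongrightarrow> \<tau>"
    using Cauchy_convergent convergent_def by blast
  have "cmod (\<alpha> * \<tau> + l u) \<le> sqrt (Q (add (sc \<alpha> f0) u))" if u: "u \<in> D" for \<alpha> u
  proof (rule LIMSEQ_le)
    define g where "g = add (sc \<alpha> f0) u"
    have g: "g \<in> C"
      using u inC f0 by (simp add: g_def add_closed sc_closed)
    show "(\<lambda>n. cmod (\<alpha> * l (m n) + l u)) \<longlonglongrightarrow> cmod (\<alpha> * \<tau> + l u)"
      by (intro tendsto_intros \<tau>)
    show "(\<lambda>n. sqrt (Q (add (sc \<alpha> f0) u)) + cmod \<alpha> * inverse (real (Suc n)))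
        \<longlonglongrightarrow> sqrt (Q (add (sc \<alpha> f0) u))"
      using tendsto_add[OF tendsto_const tendsto_mult_left[OF LIMSEQ_inverse_real_of_nat, of "cmod \<alpha>"]]
      by simp
    have "cmod (\<alpha> * l (m n) + l u) \<le> sqrt (Q g) + cmod \<alpha> * inverse (real (Suc n))" for n
    proof -
      define w where "w = add (sc \<alpha> (m n)) u"
      have w: "w \<in> D"
        using m u by (simp add: w_def D.add_closed D.sc_closed)
      have "\<alpha> * l (m n) + l u = l w"
        using m u by (simp add: w_def l_add l_sc D.sc_closed)
      \<comment> \<open>Tested against \<open>D\<close>, \<open>w\<close> agrees with
        \<open>g\<close> up to \<open>cmod \<alpha>\<close> times the error of \<open>m n\<close>:
        it is nearly the projection of \<open>g\<close>, hence hardly longer than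
        \<open>g\<close>.\<close>
      moreover have "sqrt (Q w) \<le> sqrt (Q g) + cmod \<alpha> * inverse (real (Suc n))"
      proof (rule D.Q_le_if_bounded)
        fix e assume e: "e \<in> D"
        have "ip w e = ip g e - \<alpha> * (ip f0 e - ip (m n) e)"
          using e m u f0 inC
          by (simp add: w_def g_def ip_add_left ip_sc_left sc_closed algebra_simps)
        then have "cmod (ip w e) \<le> cmod (ip g e) + cmod \<alpha> * cmod (ip f0 e - ip (m n) e)"
          by (metis norm_mult norm_triangle_ineq4)
        also have "\<dots> \<le> sqrt (Q g) * sqrt (Q e) + cmod \<alpha> * (inverse (real (Suc n)) * sqrt (Q e))"
          using approx[OF e, of n] cauchy_schwarz[OF g inC[OF e]]
          by (intro add_mono mult_left_mono) auto
        finally show "cmod (ip w e) \<le> (sqrt (Q g) + cmod \<alpha> * inverse (real (Suc n))) * sqrt (Q e)"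
          by (simp add: algebra_simps)
      qed (use w Q_nonneg[OF g] in auto)
      ultimately show ?thesis
        using l_le[OF w] by simp
    qed
    then show "\<exists>N. \<forall>n\<ge>N. cmod (\<alpha> * l (m n) + l u)
        \<le> sqrt (Q (add (sc \<alpha> f0) u)) + cmod \<alpha> * inverse (real (Suc n))"
      by (auto simp: g_def)
  qed
  then show ?thesis
    by blast
qed

end

lemma semi_inner_cinner: "semi_inner UNIV (+) (*\<^sub>C) (cinner :: 'e::chilbert_space \<Rightarrow> 'e \<Rightarrow> complex)"
proof
  show "cinner f g = cnj (cinner g f)" for f g :: 'e
    by (rule cinner_commute)
qed (auto simp: cinner_add_left cinner_scaleC_left Re_cinner_self)

lemma norm_cinner_le: "cmod (cinner v w) \<le> norm v * norm (w::'e::chilbert_space)"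
proof -
  interpret semi_inner UNIV "(+)" "(*\<^sub>C)" "cinner :: 'e \<Rightarrow> 'e \<Rightarrow> complex"
    by (rule semi_inner_cinner)
  show ?thesis
    using cauchy_schwarz[of v w] by (simp add: Q_def Re_cinner_self)
qed

lemma tendsto_cinner_left:
  fixes f :: "'b \<Rightarrow> 'e::chilbert_space"
  assumes "(f \<longlongrightarrow> l) F"
  shows "((\<lambda>n. cinner (f n) v) \<longlongrightarrow> cinner l v) F"
proof -
  have "((\<lambda>n. cinner (f n - l) v) \<longlongrightarrow> 0) F"
  proof (rule Lim_null_comparison)
    show "\<forall>\<^sub>F n in F. norm (cinner (f n - l) v) \<le> norm (f n - l) * norm v"
      by (simp add: norm_cinner_le)
    show "((\<lambda>n. norm (f n - l) * norm v) \<longlongrightarrow> 0) F"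
      using tendsto_mult_right[OF tendsto_norm[OF LIM_zero[OF assms]], of "norm v"] by simp
  qed
  then show ?thesis
    by (simp add: cinner_diff_left LIM_zero_iff)
qed

subsection \<open>Formal combinations of kernel functions\<close>

text \<open>In a kernel space this is the inner product of f with the combination of kernel
  functions listed in \<open>c\<close> (see \<open>ip_kfun\<close>), but it makes sense for any
  function f, before a space is available.\<close>

definition pairing :: "('p \<Rightarrow> 'e::chilbert_space) \<Rightarrow> ('p \<times> 'e) list \<Rightarrow> complex"
  where "pairing f c = (\<Sum>(p, v)\<leftarrow>c. cinner (f p) v)"

definition kfun :: "('p \<Rightarrow> 'p \<Rightarrow> complex) \<Rightarrow> ('p \<times> 'e::chilbert_space) list \<Rightarrow> 'p \<Rightarrow> 'e"
  where "kfun K c x = (\<Sum>(q, v)\<leftarrow>c. K x q *\<^sub>C v)"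

definition lsc :: "complex \<Rightarrow> ('p \<times> 'e::chilbert_space) list \<Rightarrow> ('p \<times> 'e) list"
  where "lsc z = map (\<lambda>(p, v). (p, z *\<^sub>C v))"

text \<open>The Gram form of kernel functions, linear in \<open>c\<close> and conjugate linear in
  \<open>d\<close>.\<close>

definition bform ::
    "('p \<Rightarrow> 'p \<Rightarrow> complex) \<Rightarrow> ('p \<times> 'e::chilbert_space) list \<Rightarrow> ('p \<times> 'e) list \<Rightarrow> complex"
  where "bform K c d = pairing (kfun K c) d"

lemma pairing_simps [simp]:
  "pairing f [] = 0"
  "pairing f (a # c) = cinner (f (fst a)) (snd a) + pairing f c"
  "pairing f (c @ d) = pairing f c + pairing f d"
  by (auto simp: pairing_def case_prod_beta)

lemma kfun_simps [simp]:
  "kfun K [] x = 0"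
  "kfun K (a # c) x = K x (fst a) *\<^sub>C snd a + kfun K c x"
  "kfun K (c @ d) x = kfun K c x + kfun K d x"
  by (auto simp: kfun_def case_prod_beta)

lemma lsc_simps [simp]:
  "lsc z [] = []"
  "lsc z (a # c) = (fst a, z *\<^sub>C snd a) # lsc z c"
  "fst ` set (lsc z c) = fst ` set c"
  by (auto simp: lsc_def case_prod_beta image_image)

lemma pairing_lsc: "pairing f (lsc z c) = cnj z * pairing f c"
  by (induction c) (auto simp: cinner_scaleC_right algebra_simps)

lemma kfun_lsc: "kfun K (lsc z c) x = z *\<^sub>C kfun K c x"
  by (induction c) (auto simp: scaleC_add_right scaleC_scaleC mult.commute)

lemma kfun_Cons: "kfun K (a # c) = (\<lambda>x. K x (fst a) *\<^sub>C snd a + kfun K c x)"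
  and kfun_append: "kfun K (c @ d) = (\<lambda>x. kfun K c x + kfun K d x)"
  and kfun_lsc': "kfun K (lsc z c) = (\<lambda>x. z *\<^sub>C kfun K c x)"
  by (auto simp: kfun_lsc)

lemma pairing_add: "pairing (\<lambda>x. f x + g x) c = pairing f c + pairing g c"
  by (induction c) (auto simp: cinner_add_left)

lemma pairing_scaleC: "pairing (\<lambda>x. z *\<^sub>C f x) c = z * pairing f c"
  by (induction c) (auto simp: cinner_scaleC_left algebra_simps)

lemma pairing_diff: "pairing (\<lambda>x. f x - g x) c = pairing f c - pairing g c"
  by (induction c) (auto simp: cinner_diff_left)

lemma pairing_inject:
  assumes "\<And>c. pairing f c = pairing g c"
  shows "f = g"
proof
  fix x
  have "cinner (f x - g x) v = 0" for v
    using assms[of "[(x, v)]"] by (simp add: cinner_diff_left)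
  then show "f x = g x"
    using cinner_eq_zeroD[of "f x - g x"] by simp
qed

lemma pairing_zero [simp]: "pairing (\<lambda>x. 0) c = 0"
  by (induction c) auto

lemma bform_Cons_left: "bform K (a # c) d = bform K [a] d + bform K c d"
  by (simp add: bform_def kfun_Cons pairing_add)

text \<open>Symmetry of \<open>K\<close> is asked only at the points that occur, since some kernels
  below are controlled only on a subset of their index set.\<close>

lemma bform_commute:
  assumes "\<And>p q. p \<in> fst ` set c \<Longrightarrow> q \<in> fst ` set d \<Longrightarrow> K p q = cnj (K q p)"
  shows "bform K c d = cnj (bform K d c)"
  using assms
proof (induction c)
  case (Cons a c)
  have "bform K [a] d = cnj (\<Sum>b\<leftarrow>d. cinner (K (fst a) (fst b) *\<^sub>C snd b) (snd a))"
    using Cons.prems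
  proof (induction d)
    case (Cons b d)
    have IH: "bform K [a] d = cnj (\<Sum>b\<leftarrow>d. cinner (K (fst a) (fst b) *\<^sub>C snd b) (snd a))"
      by (rule Cons.IH, rule Cons.prems) auto
    have "K (fst b) (fst a) = cnj (K (fst a) (fst b))"
      by (rule Cons.prems[of "fst a" "fst b", THEN arg_cong[of _ _ cnj], simplified, symmetric])
    then have "cinner (K (fst b) (fst a) *\<^sub>C snd a) (snd b)
        = cnj (cinner (K (fst a) (fst b) *\<^sub>C snd b) (snd a))"
      using cinner_commute[of "snd a" "snd b"] by (simp add: cinner_scaleC_left)
    then show ?case
      using IH by (simp add: bform_def)
  qed (simp add: bform_def)
  also have "(\<Sum>b\<leftarrow>d. cinner (K (fst a) (fst b) *\<^sub>C snd b) (snd a)) = cinner (kfun K d (fst a)) (snd a)"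
    by (induction d) (auto simp: cinner_add_left)
  finally have "bform K [a] d = cnj (cinner (kfun K d (fst a)) (snd a))" .
  moreover have "bform K c d = cnj (bform K d c)"
    by (rule Cons.IH, rule Cons.prems) auto
  moreover have "bform K d (a # c) = cinner (kfun K d (fst a)) (snd a) + bform K d c"
    by (simp add: bform_def)
  ultimately show ?case
    by (simp add: bform_Cons_left[of K a c])
qed (simp add: bform_def kfun_def pairing_def case_prod_beta, induction d, auto)

lemma semi_inner_bform:
  assumes "\<And>p q. p \<in> S \<Longrightarrow> q \<in> S \<Longrightarrow> K p q = cnj (K q p)"
    and "\<And>c :: ('p \<times> 'e::chilbert_space) list. fst ` set c \<subseteq> S \<Longrightarrow> 0 \<le> Re (bform K c c)"
  shows "semi_inner {c :: ('p \<times> 'e) list. fst ` set c \<subseteq> S} (@) lsc (bform K)"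
proof
  fix c d :: "('p \<times> 'e) list"
  assume "c \<in> {c. fst ` set c \<subseteq> S}" "d \<in> {c. fst ` set c \<subseteq> S}"
  then have "fst ` set c \<subseteq> S" "fst ` set d \<subseteq> S"
    by auto
  then show "bform K c d = cnj (bform K d c)"
    using assms(1) by (intro bform_commute) blast
qed (use assms(2) in \<open>auto simp: bform_def pairing_add pairing_scaleC kfun_append kfun_lsc' intro: exI[of _ "[]"]\<close>)

subsection \<open>Function spaces\<close>

lemma hilbert_fspaceD:
  assumes "hilbert_fspace S"
  shows "(\<lambda>x. 0) \<in> elems S"
    "f \<in> elems S \<Longrightarrow> g \<in> elems S \<Longrightarrow> (\<lambda>x. f x + g x) \<in> elems S"
    "f \<in> elems S \<Longrightarrow> (\<lambda>x. z *\<^sub>C f x) \<in> elems S"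
    "f \<in> elems S \<Longrightarrow> g \<in> elems S \<Longrightarrow> ip S f g = cnj (ip S g f)"
    "f \<in> elems S \<Longrightarrow> g \<in> elems S \<Longrightarrow> l \<in> elems S \<Longrightarrow> ip S (\<lambda>x. f x + g x) l = ip S f l + ip S g l"
    "f \<in> elems S \<Longrightarrow> g \<in> elems S \<Longrightarrow> ip S (\<lambda>x. z *\<^sub>C f x) g = z * ip S f g"
    "f \<in> elems S \<Longrightarrow> f \<noteq> (\<lambda>x. 0) \<Longrightarrow> 0 < Re (ip S f f)"
    "(\<And>n. s n \<in> elems S) \<Longrightarrow> (\<And>\<epsilon>. \<epsilon> > 0 \<Longrightarrow> \<exists>N. \<forall>m\<ge>N. \<forall>n\<ge>N. fnorm S (\<lambda>x. s m x - s n x) < \<epsilon>)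
      \<Longrightarrow> \<exists>f\<in>elems S. (\<lambda>n. fnorm S (\<lambda>x. s n x - f x)) \<longlonglongrightarrow> 0"
proof -
  note H = assms[unfolded hilbert_fspace_def]
  show "(\<lambda>x. 0) \<in> elems S"
    "f \<in> elems S \<Longrightarrow> g \<in> elems S \<Longrightarrow> (\<lambda>x. f x + g x) \<in> elems S"
    "f \<in> elems S \<Longrightarrow> (\<lambda>x. z *\<^sub>C f x) \<in> elems S"
    "f \<in> elems S \<Longrightarrow> g \<in> elems S \<Longrightarrow> ip S f g = cnj (ip S g f)"
    "f \<in> elems S \<Longrightarrow> g \<in> elems S \<Longrightarrow> l \<in> elems S \<Longrightarrow> ip S (\<lambda>x. f x + g x) l = ip S f l + ip S g l"
    "f \<in> elems S \<Longrightarrow> g \<in> elems S \<Longrightarrow> ip S (\<lambda>x. z *\<^sub>C f x) g = z * ip S f g"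
    "f \<in> elems S \<Longrightarrow> f \<noteq> (\<lambda>x. 0) \<Longrightarrow> 0 < Re (ip S f f)"
    using H by blast+
  have "\<forall>s :: nat \<Rightarrow> _. (\<forall>n. s n \<in> elems S) \<and>
      (\<forall>\<epsilon>>0. \<exists>N. \<forall>m\<ge>N. \<forall>n\<ge>N. fnorm S (\<lambda>x. s m x - s n x) < \<epsilon>) \<longrightarrow>
      (\<exists>f\<in>elems S. (\<lambda>n. fnorm S (\<lambda>x. s n x - f x)) \<longlonglongrightarrow> 0)"
    using H by (elim conjE)
  then show "\<exists>f\<in>elems S. (\<lambda>n. fnorm S (\<lambda>x. s n x - f x)) \<longlonglongrightarrow> 0"
    if "\<And>n. s n \<in> elems S"
      "\<And>\<epsilon>. \<epsilon> > 0 \<Longrightarrow> \<exists>N. \<forall>m\<ge>N. \<forall>n\<ge>N. fnorm S (\<lambda>x. s m x - s n x) < \<epsilon>"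
    using that by blast
qed

lemma fspace_semi_inner:
  assumes "hilbert_fspace S"
  shows "semi_inner (elems S) (\<lambda>f g x. f x + g x) (\<lambda>z f x. z *\<^sub>C f x) (ip S)"
proof
  show "0 \<le> Re (ip S f f)" if "f \<in> elems S" for f
  proof (cases "f = (\<lambda>x. 0)")
    case True
    then show ?thesis
      using hilbert_fspaceD(6)[OF assms that that, of 0] by simp
  qed (use hilbert_fspaceD(7)[OF assms that] in auto)
  show "ip S f g = cnj (ip S g f)" if "f \<in> elems S" "g \<in> elems S" for f g
    by (rule hilbert_fspaceD(4)[OF assms that])
qed (use hilbert_fspaceD(1-3,5,6)[OF assms] in auto)

locale hilbert_function_space =
  fixes S :: "('x, 'e::chilbert_space) fspace"
  assumes hilbert: "hilbert_fspace S"
begin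

sublocale semi_inner "elems S" "\<lambda>f g x. f x + g x" "\<lambda>z f x. z *\<^sub>C f x" "ip S"
  by (rule fspace_semi_inner[OF hilbert])

lemma sub_eq: "sub f g = (\<lambda>x. f x - g x)"
  by (simp add: sub_def scaleC_minus_one)

lemma fnorm_eq: "fnorm S f = sqrt (Q f)"
  by (simp add: fnorm_def Q_def)

lemma zero_in: "(\<lambda>x. 0) \<in> elems S"
  using hilbert hilbert_fspaceD(1) by blast

lemma ip_zero_right [simp]: "f \<in> elems S \<Longrightarrow> ip S f (\<lambda>x. 0) = 0"
  using ip_sc_right[OF _ zero_in, of f 0] by simp

text \<open>Completeness in the form that fits the approximants of \<open>riesz_approx\<close>. Only
  the weak limit is recorded, as inner products are all that is compared later.\<close>

lemma limit_exists:
  assumes "\<And>n. s n \<in> elems S"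
    and "\<And>m n. sqrt (Q (sub (s m) (s n))) \<le> inverse (real (Suc m)) + inverse (real (Suc n))"
  shows "\<exists>f\<in>elems S. \<forall>e\<in>elems S. (\<lambda>n. ip S (s n) e) \<longlonglongrightarrow> ip S f e"
proof -
  have "\<exists>N. \<forall>m\<ge>N. \<forall>n\<ge>N. fnorm S (\<lambda>x. s m x - s n x) < \<epsilon>" if "\<epsilon> > 0" for \<epsilon>
  proof -
    have "\<forall>\<^sub>F n in sequentially. inverse (real (Suc n)) < \<epsilon> / 2"
      using LIMSEQ_inverse_real_of_nat that by (intro order_tendstoD) auto
    then obtain N where N: "\<And>n. n \<ge> N \<Longrightarrow> inverse (real (Suc n)) < \<epsilon> / 2"
      by (auto simp: eventually_sequentially)
    have "fnorm S (\<lambda>x. s m x - s n x) < \<epsilon>" if "m \<ge> N" "n \<ge> N" for m n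
      using assms(2)[of m n] N[OF that(1)] N[OF that(2)] by (simp add: fnorm_eq sub_eq)
    then show ?thesis
      by blast
  qed
  then obtain f where f: "f \<in> elems S" and lim: "(\<lambda>n. fnorm S (\<lambda>x. s n x - f x)) \<longlonglongrightarrow> 0"
    using hilbert_fspaceD(8)[OF hilbert, of s] assms(1) by blast
  have "(\<lambda>n. ip S (s n) e) \<longlonglongrightarrow> ip S f e" if e: "e \<in> elems S" for e
  proof -
    have "(\<lambda>n. ip S (s n) e - ip S f e) \<longlonglongrightarrow> 0"
    proof (rule Lim_null_comparison)
      show "\<forall>\<^sub>F n in sequentially. norm (ip S (s n) e - ip S f e)
          \<le> fnorm S (\<lambda>x. s n x - f x) * sqrt (Q e)"
        using cauchy_schwarz[OF sub_closed[OF assms(1) f] e] ip_sub_left[OF assms(1) f e]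
        by (simp add: fnorm_eq sub_eq)
      show "(\<lambda>n. fnorm S (\<lambda>x. s n x - f x) * sqrt (Q e)) \<longlonglongrightarrow> 0"
        using tendsto_mult_right[OF lim, of "sqrt (Q e)"] by simp
    qed
    then show ?thesis
      by (simp add: LIM_zero_iff)
  qed
  then show ?thesis
    using f by blast
qed

end

locale kernel_space = hilbert_function_space S for S :: "('x, 'e::chilbert_space) fspace" +
  fixes k :: "'x \<Rightarrow> 'x \<Rightarrow> complex"
  assumes kernel: "has_kernel S k"
begin

lemma kfun_in: "kfun k c \<in> elems S"
proof (induction c)
  case Nil
  then show ?case
    using zero_in by (simp add: kfun_def)
next
  case (Cons a c)
  have "(\<lambda>x. k x (fst a) *\<^sub>C snd a) \<in> elems S"
    using kernel by (simp add: has_kernel_def)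
  from add_closed[OF this Cons] show ?case
    by (simp add: kfun_Cons)
qed

lemma ip_kfun: "f \<in> elems S \<Longrightarrow> ip S f (kfun k c) = pairing f c"
proof (induction c)
  case Nil
  then show ?case
    using zero_in by (simp add: kfun_def)
next
  case (Cons a c)
  have *: "(\<lambda>x. k x (fst a) *\<^sub>C snd a) \<in> elems S"
      "ip S f (\<lambda>x. k x (fst a) *\<^sub>C snd a) = cinner (f (fst a)) (snd a)"
    using kernel Cons by (auto simp add: has_kernel_def)
  show ?case
    using ip_add_right[OF *(1) kfun_in Cons.prems] * Cons by (simp add: kfun_Cons)
qed

lemma Q_kfun: "Q (kfun k c) = Re (bform k c c)"
  by (simp add: Q_def ip_kfun kfun_in bform_def)

lemma pairing_bound: "f \<in> elems S \<Longrightarrow> cmod (pairing f c) \<le> fnorm S f * sqrt (Re (bform k c c))"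
  using cauchy_schwarz[OF _ kfun_in, of f c] by (simp add: ip_kfun fnorm_eq Q_kfun)

end

subsection \<open>The space of bounded functionals\<close>

text \<open>The token \<open>E\<close> fixes the value space: positivity is a statement about lists
  with vectors in that space.\<close>

locale positive_kernel =
  fixes k :: "'x \<Rightarrow> 'x \<Rightarrow> complex" and E :: "'e::chilbert_space itself"
  assumes herm: "k x y = cnj (k y x)"
    and pos: "0 \<le> Re (bform k c (c :: ('x \<times> 'e) list))"
begin

sublocale L: semi_inner "UNIV :: ('x \<times> 'e) list set" "(@)" lsc "bform k"
  using semi_inner_bform[of UNIV k, OF herm pos] by simp

text \<open>The ball of radius \<open>M\<close> of the future space, described through
  \<open>k\<close> alone.\<close>

definition bounded_by :: "('x \<Rightarrow> 'e) \<Rightarrow> real \<Rightarrow> bool"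
  where "bounded_by f M \<longleftrightarrow> 0 \<le> M \<and> (\<forall>c. cmod (pairing f c) \<le> M * sqrt (L.Q c))"

definition dual :: "('x \<Rightarrow> 'e) set" where "dual = {f. \<exists>M. bounded_by f M}"

text \<open>Stands in for the completion: a Cauchy sequence of formal combinations that represents
  f.\<close>

definition apx :: "('x \<Rightarrow> 'e) \<Rightarrow> nat \<Rightarrow> ('x \<times> 'e) list"
  where "apx f = (SOME c. \<forall>n e.
    cmod (pairing f e - bform k (c n) e) \<le> inverse (real (Suc n)) * sqrt (L.Q e))"

lemma apx:
  assumes "f \<in> dual"
  shows "cmod (pairing f e - bform k (apx f n) e) \<le> inverse (real (Suc n)) * sqrt (L.Q e)"
proof -
  obtain M where "bounded_by f M"
    using assms by (auto simp: dual_def)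
  then have "\<exists>c. \<forall>n. c n \<in> UNIV \<and> (\<forall>e\<in>UNIV.
      cmod (pairing f e - bform k (c n) e) \<le> inverse (real (Suc n)) * sqrt (L.Q e))"
    by (intro L.riesz_approx[where M = M]) (auto simp: pairing_lsc bounded_by_def)
  then have "\<exists>c. \<forall>n e.
      cmod (pairing f e - bform k (c n) e) \<le> inverse (real (Suc n)) * sqrt (L.Q e)"
    by blast
  from someI_ex[OF this] show ?thesis
    unfolding apx_def by blast
qed

lemma pairing_sub: "pairing f (L.sub c d) = pairing f c - pairing f d"
  by (simp add: L.sub_def pairing_lsc)

lemma apx_cauchy:
  "f \<in> dual \<Longrightarrow> sqrt (L.Q (L.sub (apx f m) (apx f n))) \<le> inverse (real (Suc m)) + inverse (real (Suc n))"
  by (rule L.approx_cauchy[where \<phi> = "pairing f"]) (auto simp: apx simp del: of_nat_Suc)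

lemma apx_tendsto: "f \<in> dual \<Longrightarrow> (\<lambda>n. bform k (apx f n) e) \<longlonglongrightarrow> pairing f e"
  by (rule L.approx_tendsto[where \<phi> = "pairing f"]) (auto simp: apx simp del: of_nat_Suc)

lemma apx_Q_le:
  assumes "bounded_by f M"
  shows "sqrt (L.Q (apx f n)) \<le> M + inverse (real (Suc n))"
proof -
  have "f \<in> dual"
    using assms by (auto simp: dual_def)
  then show ?thesis
    using assms by (intro L.approx_Q_le[where \<phi> = "pairing f"]) (simp_all add: apx bounded_by_def del: of_nat_Suc)
qed

text \<open>One direction is Cauchy-Schwarz. For the other, the approximants of f converge in
  \<open>S\<close> to a function with the same pairings, hence to f. The set and the norm of a
  kernel space are therefore determined by \<open>k\<close>.\<close>

lemma kernel_space_char: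
  assumes "hilbert_fspace S" "has_kernel S k"
  shows "f \<in> elems S \<and> fnorm S f \<le> M \<longleftrightarrow> bounded_by f M"
proof -
  interpret S: kernel_space S k
    using assms by unfold_locales
  show ?thesis
  proof
    assume f: "f \<in> elems S \<and> fnorm S f \<le> M"
    have "cmod (pairing f c) \<le> M * sqrt (L.Q c)" for c
    proof -
      have "cmod (pairing f c) \<le> fnorm S f * sqrt (L.Q c)"
        using S.pairing_bound f by (simp add: L.Q_def)
      also have "\<dots> \<le> M * sqrt (L.Q c)"
        using f L.Q_nonneg by (intro mult_right_mono) auto
      finally show ?thesis .
    qed
    moreover have "0 \<le> fnorm S f"
      using f by (simp add: S.fnorm_eq S.Q_nonneg)
    ultimately show "bounded_by f M"
      using f by (auto simp: bounded_by_def)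
  next
    assume bd: "bounded_by f M"
    then have f: "f \<in> dual"
      by (auto simp: dual_def)
    define s where "s n = kfun k (apx f n)" for n
    have s: "s n \<in> elems S" for n
      by (simp add: s_def S.kfun_in)
    have "S.sub (s m) (s n) = kfun k (L.sub (apx f m) (apx f n))" for m n
      by (simp add: S.sub_eq s_def L.sub_def kfun_lsc scaleC_minus_one fun_eq_iff)
    then have "sqrt (S.Q (S.sub (s m) (s n))) \<le> inverse (real (Suc m)) + inverse (real (Suc n))" for m n
      using apx_cauchy[OF f, of m n] by (simp add: S.Q_kfun L.Q_def)
    then obtain g where g: "g \<in> elems S" and lim: "\<And>e. e \<in> elems S \<Longrightarrow> (\<lambda>n. ip S (s n) e) \<longlonglongrightarrow> ip S g e"
      using S.limit_exists[of s, OF s] by blast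
    have "pairing g c = pairing f c" for c
    proof -
      have "(\<lambda>n. bform k (apx f n) c) \<longlonglongrightarrow> pairing g c"
        using lim[OF S.kfun_in, of c] s g by (simp add: S.ip_kfun) (simp add: s_def bform_def)
      then show ?thesis
        using apx_tendsto[OF f, of c] LIMSEQ_unique by blast
    qed
    then have [simp]: "g = f"
      by (rule pairing_inject)
    \<comment> \<open>Testing the approximants, whose norms are at most M + 1/(n+1), against f
      itself gives the sharp constant \<open>M\<close>.\<close>
    have "cmod (ip S f f) \<le> M * sqrt (S.Q f)"
    proof (rule LIMSEQ_le)
      show "(\<lambda>n. cmod (ip S (s n) f)) \<longlonglongrightarrow> cmod (ip S f f)"
        using lim g by (intro tendsto_norm) simp
      show "(\<lambda>n. (M + inverse (real (Suc n))) * sqrt (S.Q f)) \<longlonglongrightarrow> M * sqrt (S.Q f)"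
        using tendsto_mult_right[OF LIMSEQ_inverse_real_of_nat_add] by blast
      have "cmod (ip S (s n) f) \<le> (M + inverse (real (Suc n))) * sqrt (S.Q f)" for n
      proof -
        have "cmod (ip S (s n) f) \<le> sqrt (S.Q (s n)) * sqrt (S.Q f)"
          using S.cauchy_schwarz s g by simp
        also have "\<dots> \<le> (M + inverse (real (Suc n))) * sqrt (S.Q f)"
          using apx_Q_le[OF bd, of n] S.Q_nonneg[of f] g
          by (intro mult_right_mono) (auto simp: s_def S.Q_kfun L.Q_def)
        finally show ?thesis .
      qed
      then show "\<exists>N. \<forall>n\<ge>N. cmod (ip S (s n) f) \<le> (M + inverse (real (Suc n))) * sqrt (S.Q f)"
        by blast
    qed
    then have "sqrt (S.Q f) * sqrt (S.Q f) \<le> M * sqrt (S.Q f)"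
      using g by (simp add: S.ip_self S.Q_nonneg)
    moreover have "0 \<le> sqrt (S.Q f)" "0 \<le> M"
      using g bd by (auto simp: S.Q_nonneg bounded_by_def)
    ultimately have "sqrt (S.Q f) \<le> M"
      by (metis mult_right_le_imp_le order_le_less)
    then show "f \<in> elems S \<and> fnorm S f \<le> M"
      using g by (simp add: S.fnorm_eq)
  qed
qed

text \<open>Equal balls give equal norms, polarization (with a factor \<i> for the imaginary part)
  gives equal inner products on the space, and the convention off the space gives equality of the
  records.\<close>

lemma kernel_space_unique:
  assumes S: "hilbert_fspace S" "has_kernel S k" "\<And>f g. f \<notin> elems S \<or> g \<notin> elems S \<Longrightarrow> ip S f g = 0"
    and S': "hilbert_fspace S'" "has_kernel S' k" "\<And>f g. f \<notin> elems S' \<or> g \<notin> elems S' \<Longrightarrow> ip S' f g = 0"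
  shows "S = (S' :: ('x, 'e) fspace)"
proof -
  interpret S: kernel_space S k
    using S by unfold_locales
  interpret S': kernel_space S' k
    using S' by unfold_locales
  have iff: "f \<in> elems S \<and> fnorm S f \<le> M \<longleftrightarrow> f \<in> elems S' \<and> fnorm S' f \<le> M" for f M
    using kernel_space_char[OF S(1,2)] kernel_space_char[OF S'(1,2)] by blast
  have el: "elems S = elems S'"
    using iff by blast
  have "fnorm S f = fnorm S' f" if "f \<in> elems S" for f
    using iff[of f "fnorm S f"] iff[of f "fnorm S' f"] that el by simp
  then have Q: "S.Q f = S'.Q f" if "f \<in> elems S" for f
    using that by (simp add: S.fnorm_eq S'.fnorm_eq)
  have Re: "Re (ip S f g) = Re (ip S' f g)" if "f \<in> elems S" "g \<in> elems S" for f g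
    using S.Q_add_sc[OF that, of 1] S'.Q_add_sc[of f g 1] Q[OF S.add_closed[OF that]] Q that el
    by simp
  have "ip S f g = ip S' f g" if fg: "f \<in> elems S" "g \<in> elems S" for f g
  proof (rule complex_eqI)
    show "Re (ip S f g) = Re (ip S' f g)"
      by (rule Re[OF fg])
    have "Re (ip S (\<lambda>x. \<i> *\<^sub>C f x) g) = Re (ip S' (\<lambda>x. \<i> *\<^sub>C f x) g)"
      using Re[OF S.sc_closed[OF fg(1)] fg(2)] .
    then show "Im (ip S f g) = Im (ip S' f g)"
      using fg el by (simp add: S.ip_sc_left S'.ip_sc_left)
  qed
  then have "ip S = ip S'"
    using el S(3) S'(3) by (intro ext) metis
  then show ?thesis
    using el by simp
qed

text \<open>The limit extends the reproducing identity from combinations of kernel functions to all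
  g. The value 0 off \<open>dual\<close> matches the normalization in \<open>rkhs\<close>.\<close>

definition dual_ip :: "('x \<Rightarrow> 'e) \<Rightarrow> ('x \<Rightarrow> 'e) \<Rightarrow> complex"
  where "dual_ip f g = (if f \<in> dual \<and> g \<in> dual then lim (\<lambda>n. pairing f (apx g n)) else 0)"

lemma dual_ip_tendsto:
  assumes f: "f \<in> dual" and g: "g \<in> dual"
  shows "(\<lambda>n. pairing f (apx g n)) \<longlonglongrightarrow> dual_ip f g"
proof -
  obtain M where M: "bounded_by f M"
    using f by (auto simp: dual_def)
  have "Cauchy (\<lambda>n. pairing f (apx g n))"
  proof (rule Cauchy_if_inverse_bound)
    fix m n
    have "dist (pairing f (apx g m)) (pairing f (apx g n)) = cmod (pairing f (L.sub (apx g m) (apx g n)))"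
      by (simp add: pairing_sub dist_norm)
    also have "\<dots> \<le> M * sqrt (L.Q (L.sub (apx g m) (apx g n)))"
      using M by (simp add: bounded_by_def)
    also have "\<dots> \<le> M * (inverse (real (Suc m)) + inverse (real (Suc n)))"
      using M apx_cauchy[OF g] by (intro mult_left_mono) (auto simp: bounded_by_def)
    finally show "dist (pairing f (apx g m)) (pairing f (apx g n))
        \<le> M * (inverse (real (Suc m)) + inverse (real (Suc n)))" .
  qed
  then show ?thesis
    using f g by (simp add: dual_ip_def Cauchy_convergent_iff convergent_LIMSEQ_iff)
qed

text \<open>Approximating both arguments makes the limit symmetric in form; Hermitian symmetry and
  the formula for the norm are read off from it.\<close>

lemma dual_ip_tendsto_bform:
  assumes f: "f \<in> dual" and g: "g \<in> dual"
  shows "(\<lambda>n. bform k (apx f n) (apx g n)) \<longlonglongrightarrow> dual_ip f g"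
proof -
  obtain M where M: "bounded_by g M"
    using g by (auto simp: dual_def)
  have "(\<lambda>n. pairing f (apx g n) - bform k (apx f n) (apx g n)) \<longlonglongrightarrow> 0"
  proof (rule Lim_null_comparison)
    have "norm (pairing f (apx g n) - bform k (apx f n) (apx g n)) \<le> inverse (real (Suc n)) * (M + 1)" for n
    proof -
      have "norm (pairing f (apx g n) - bform k (apx f n) (apx g n))
          \<le> inverse (real (Suc n)) * sqrt (L.Q (apx g n))"
        by (rule apx[OF f])
      also have "\<dots> \<le> inverse (real (Suc n)) * (M + 1)"
      proof (rule mult_left_mono)
        show "sqrt (L.Q (apx g n)) \<le> M + 1"
          using apx_Q_le[OF M, of n] by (smt (verit) inverse_le_1_iff of_nat_1 of_nat_mono Suc_le_mono One_nat_def le0)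
      qed simp
      finally show ?thesis .
    qed
    then show "\<forall>\<^sub>F n in sequentially. norm (pairing f (apx g n) - bform k (apx f n) (apx g n))
        \<le> inverse (real (Suc n)) * (M + 1)"
      by simp
    show "(\<lambda>n. inverse (real (Suc n)) * (M + 1)) \<longlonglongrightarrow> 0"
      using tendsto_mult_right[OF LIMSEQ_inverse_real_of_nat, of "M + 1"] by simp
  qed
  from tendsto_diff[OF dual_ip_tendsto[OF f g] this] show ?thesis
    by simp
qed

lemma dual_ip_commute: "dual_ip f g = cnj (dual_ip g f)"
proof (cases "f \<in> dual \<and> g \<in> dual")
  case True
  have "(\<lambda>n. bform k (apx f n) (apx g n)) = (\<lambda>n. cnj (bform k (apx g n) (apx f n)))"
    by (intro ext L.ip_commute) auto
  then have "(\<lambda>n. cnj (bform k (apx g n) (apx f n))) \<longlonglongrightarrow> dual_ip f g"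
    using dual_ip_tendsto_bform[of f g] True by metis
  moreover have "(\<lambda>n. cnj (bform k (apx g n) (apx f n))) \<longlonglongrightarrow> cnj (dual_ip g f)"
    using dual_ip_tendsto_bform[of g f] True by (intro tendsto_cnj) simp
  ultimately show ?thesis
    using LIMSEQ_unique by blast
qed (auto simp: dual_ip_def)

definition dual_norm :: "('x \<Rightarrow> 'e) \<Rightarrow> real"
  where "dual_norm f = sqrt (Re (dual_ip f f))"

lemma dual_norm_tendsto: "f \<in> dual \<Longrightarrow> (\<lambda>n. sqrt (L.Q (apx f n))) \<longlonglongrightarrow> dual_norm f"
  unfolding dual_norm_def L.Q_def
  by (intro tendsto_real_sqrt tendsto_Re dual_ip_tendsto_bform)

text \<open>Together with \<open>dual_norm_le\<close> this makes \<open>dual_norm f\<close> the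
  least admissible bound for f.\<close>

lemma pairing_le_dual_norm:
  assumes "f \<in> dual"
  shows "cmod (pairing f e) \<le> dual_norm f * sqrt (L.Q e)"
proof (rule LIMSEQ_le)
  show "(\<lambda>n. cmod (bform k (apx f n) e)) \<longlonglongrightarrow> cmod (pairing f e)"
    by (intro tendsto_norm apx_tendsto assms)
  show "(\<lambda>n. sqrt (L.Q (apx f n)) * sqrt (L.Q e)) \<longlonglongrightarrow> dual_norm f * sqrt (L.Q e)"
    by (intro tendsto_mult_right dual_norm_tendsto assms)
  show "\<exists>N. \<forall>n\<ge>N. cmod (bform k (apx f n) e) \<le> sqrt (L.Q (apx f n)) * sqrt (L.Q e)"
    using L.cauchy_schwarz by blast
qed

lemma dual_norm_le:
  assumes "bounded_by f M"
  shows "dual_norm f \<le> M"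
proof (rule LIMSEQ_le)
  show "(\<lambda>n. sqrt (L.Q (apx f n))) \<longlonglongrightarrow> dual_norm f"
    using assms by (intro dual_norm_tendsto) (auto simp: dual_def)
  show "(\<lambda>n. M + inverse (real (Suc n))) \<longlonglongrightarrow> M"
    by (rule LIMSEQ_inverse_real_of_nat_add)
  show "\<exists>N. \<forall>n\<ge>N. sqrt (L.Q (apx f n)) \<le> M + inverse (real (Suc n))"
    using apx_Q_le[OF assms] by blast
qed

lemma dual_norm_nonneg:
  assumes "f \<in> dual"
  shows "0 \<le> dual_norm f"
  by (rule LIMSEQ_le_const[OF dual_norm_tendsto[OF assms]]) (simp add: L.Q_nonneg)

lemma dual_add: "f \<in> dual \<Longrightarrow> g \<in> dual \<Longrightarrow> (\<lambda>x. f x + g x) \<in> dual"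
proof -
  assume "f \<in> dual" "g \<in> dual"
  then obtain M N where MN: "bounded_by f M" "bounded_by g N"
    by (auto simp: dual_def)
  have "cmod (pairing (\<lambda>x. f x + g x) c) \<le> (M + N) * sqrt (L.Q c)" for c
  proof -
    have "cmod (pairing f c) \<le> M * sqrt (L.Q c)" "cmod (pairing g c) \<le> N * sqrt (L.Q c)"
      using MN by (auto simp: bounded_by_def)
    then show ?thesis
      using norm_triangle_ineq[of "pairing f c" "pairing g c"] by (simp add: pairing_add distrib_right)
  qed
  then have "bounded_by (\<lambda>x. f x + g x) (M + N)"
    using MN by (simp add: bounded_by_def)
  then show ?thesis
    by (auto simp: dual_def)
qed

lemma dual_scaleC: "f \<in> dual \<Longrightarrow> (\<lambda>x. z *\<^sub>C f x) \<in> dual"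
proof -
  assume "f \<in> dual"
  then obtain M where M: "bounded_by f M"
    by (auto simp: dual_def)
  then have "bounded_by (\<lambda>x. z *\<^sub>C f x) (cmod z * M)"
    by (auto simp: bounded_by_def pairing_scaleC norm_mult mult.assoc intro: mult_left_mono)
  then show ?thesis
    by (auto simp: dual_def)
qed

lemma dual_zero: "(\<lambda>x. 0) \<in> dual"
proof -
  have "bounded_by (\<lambda>x. 0) 0"
    by (simp add: bounded_by_def)
  then show ?thesis
    by (auto simp: dual_def)
qed

lemma dual_diff: "f \<in> dual \<Longrightarrow> g \<in> dual \<Longrightarrow> (\<lambda>x. f x - g x) \<in> dual"
  using dual_add[OF _ dual_scaleC, of f g "-1"] by (simp add: scaleC_minus_one)

lemma dual_ip_add_left:
  assumes "f \<in> dual" "g \<in> dual" "l \<in> dual"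
  shows "dual_ip (\<lambda>x. f x + g x) l = dual_ip f l + dual_ip g l"
proof (rule LIMSEQ_unique)
  show "(\<lambda>n. pairing (\<lambda>x. f x + g x) (apx l n)) \<longlonglongrightarrow> dual_ip (\<lambda>x. f x + g x) l"
    using assms by (intro dual_ip_tendsto dual_add)
  show "(\<lambda>n. pairing (\<lambda>x. f x + g x) (apx l n)) \<longlonglongrightarrow> dual_ip f l + dual_ip g l"
    unfolding pairing_add using assms by (intro tendsto_add dual_ip_tendsto)
qed

lemma dual_ip_scaleC_left:
  assumes "f \<in> dual" "l \<in> dual"
  shows "dual_ip (\<lambda>x. z *\<^sub>C f x) l = z * dual_ip f l"
proof (rule LIMSEQ_unique)
  show "(\<lambda>n. pairing (\<lambda>x. z *\<^sub>C f x) (apx l n)) \<longlonglongrightarrow> dual_ip (\<lambda>x. z *\<^sub>C f x) l"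
    using assms by (intro dual_ip_tendsto dual_scaleC)
  show "(\<lambda>n. pairing (\<lambda>x. z *\<^sub>C f x) (apx l n)) \<longlonglongrightarrow> z * dual_ip f l"
    unfolding pairing_scaleC using assms by (intro tendsto_mult_left dual_ip_tendsto)
qed

lemma kfun_dual: "kfun k d \<in> dual"
proof -
  have "bounded_by (kfun k d) (sqrt (L.Q d))"
    using L.cauchy_schwarz[of d] by (simp add: bounded_by_def L.Q_nonneg bform_def)
  then show ?thesis
    by (auto simp: dual_def)
qed

text \<open>The reproducing property: the approximants of \<open>kfun k d\<close> lie within 1/(n+1)
  of \<open>d\<close> itself in the Gram seminorm, and the pairing with f is bounded in that
  seminorm.\<close>

lemma dual_ip_kfun:
  assumes f: "f \<in> dual"
  shows "dual_ip f (kfun k d) = pairing f d"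
proof (rule LIMSEQ_unique)
  show "(\<lambda>n. pairing f (apx (kfun k d) n)) \<longlonglongrightarrow> dual_ip f (kfun k d)"
    by (intro dual_ip_tendsto f kfun_dual)
  obtain M where M: "bounded_by f M"
    using f by (auto simp: dual_def)
  have "(\<lambda>n. pairing f (apx (kfun k d) n) - pairing f d) \<longlonglongrightarrow> 0"
  proof (rule Lim_null_comparison)
    have "norm (pairing f (apx (kfun k d) n) - pairing f d) \<le> M * inverse (real (Suc n))" for n
    proof -
      have "sqrt (L.Q (L.sub (apx (kfun k d) n) d)) \<le> inverse (real (Suc n))"
      proof (rule L.Q_le_if_bounded)
        fix e
        have "bform k (L.sub (apx (kfun k d) n) d) e = - (pairing (kfun k d) e - bform k (apx (kfun k d) n) e)"
          by (simp add: L.ip_sub_left) (simp add: bform_def)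
        then show "cmod (bform k (L.sub (apx (kfun k d) n) d) e) \<le> inverse (real (Suc n)) * sqrt (L.Q e)"
          using apx[OF kfun_dual, of d e n] by (simp only: norm_minus_cancel)
      qed auto
      then have "M * sqrt (L.Q (L.sub (apx (kfun k d) n) d)) \<le> M * inverse (real (Suc n))"
        using M by (intro mult_left_mono) (auto simp: bounded_by_def)
      moreover have "cmod (pairing f (L.sub (apx (kfun k d) n) d))
          \<le> M * sqrt (L.Q (L.sub (apx (kfun k d) n) d))"
        using M unfolding bounded_by_def by blast
      ultimately show ?thesis
        by (simp only: pairing_sub)
    qed
    then show "\<forall>\<^sub>F n in sequentially. norm (pairing f (apx (kfun k d) n) - pairing f d)
        \<le> M * inverse (real (Suc n))"
      by simp
    show "(\<lambda>n. M * inverse (real (Suc n))) \<longlonglongrightarrow> 0"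
      using tendsto_mult_left[OF LIMSEQ_inverse_real_of_nat, of M] by simp
  qed
  then show "(\<lambda>n. pairing f (apx (kfun k d) n)) \<longlonglongrightarrow> pairing f d"
    by (simp add: LIM_zero_iff)
qed

text \<open>Evaluations are bounded, so a Cauchy sequence converges pointwise. Each instance of
  \<open>bounded_by\<close> involves one finite list, so it survives the pointwise limit.\<close>

lemma dual_complete:
  assumes s: "\<And>n. s n \<in> dual"
    and cauchy: "\<And>\<epsilon>. \<epsilon> > 0 \<Longrightarrow> \<exists>N. \<forall>m\<ge>N. \<forall>n\<ge>N. dual_norm (\<lambda>x. s m x - s n x) < \<epsilon>"
  shows "\<exists>f\<in>dual. (\<lambda>n. dual_norm (\<lambda>x. s n x - f x)) \<longlonglongrightarrow> 0"
proof -
  have "convergent (\<lambda>n. s n x)" for x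
  proof -
    have "Cauchy (\<lambda>n. s n x)"
    proof (rule CauchyI)
      fix e :: real assume "0 < e"
      define K where "K = sqrt (\<bar>Re (k x x)\<bar>)"
      have "0 < e / (K + 1)"
        using \<open>0 < e\<close> by (intro divide_pos_pos) (auto simp: K_def add_nonneg_pos)
      then obtain N where N: "\<And>m n. m \<ge> N \<Longrightarrow> n \<ge> N \<Longrightarrow> dual_norm (\<lambda>x. s m x - s n x) < e / (K + 1)"
        using cauchy by blast
      have "norm (s m x - s n x) < e" if "m \<ge> N" "n \<ge> N" for m n
      proof -
        \<comment> \<open>Pairing the difference with its own value at x yields the square of the
          norm of that value.\<close>
        define v where "v = s m x - s n x"
        have "cmod (cinner v v) \<le> dual_norm (\<lambda>x. s m x - s n x) * sqrt (L.Q [(x, v)])"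
          using pairing_le_dual_norm[OF dual_diff[OF s s], of m n "[(x, v)]"] by (simp add: v_def)
        also have "cmod (cinner v v) = norm v * norm v"
          by (simp add: cinner_self power2_eq_square norm_mult)
        also have "sqrt (L.Q [(x, v)]) \<le> K * norm v"
        proof -
          have "L.Q [(x, v)] = Re (k x x) * (norm v)\<^sup>2"
            by (simp add: L.Q_def bform_def cinner_scaleC_left cinner_self)
          also have "\<dots> \<le> \<bar>Re (k x x)\<bar> * (norm v)\<^sup>2"
            by (intro mult_right_mono) auto
          finally show ?thesis
            using real_sqrt_le_mono by (fastforce simp: K_def real_sqrt_mult)
        qed
        finally have "norm v * norm v \<le> dual_norm (\<lambda>x. s m x - s n x) * (K * norm v)"
          using dual_norm_nonneg[OF dual_diff[OF s s], of m n] by (simp add: mult_left_mono)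
        then have "norm v \<le> dual_norm (\<lambda>x. s m x - s n x) * K \<or> v = 0"
          by (cases "v = 0") (auto simp: mult.assoc[symmetric])
        moreover have "dual_norm (\<lambda>x. s m x - s n x) * K \<le> e / (K + 1) * K"
          using N[OF that] by (intro mult_right_mono) (auto simp: K_def)
        moreover have "e / (K + 1) * K < e"
        proof -
          have "0 \<le> K"
            by (simp add: K_def)
          then show ?thesis
            using \<open>0 < e\<close> by (simp add: field_simps)
        qed
        ultimately show ?thesis
          using \<open>0 < e\<close> by (auto simp: v_def)
      qed
      then show "\<exists>M. \<forall>m\<ge>M. \<forall>n\<ge>M. norm (s m x - s n x) < e"
        by blast
    qed
    then show ?thesis
      by (rule Cauchy_convergent)
  qed
  then have "\<forall>x. \<exists>y. (\<lambda>n. s n x) \<longlonglongrightarrow> y"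
    by (simp add: convergent_def)
  then obtain f where f: "\<And>x. (\<lambda>n. s n x) \<longlonglongrightarrow> f x"
    by metis
  have lim: "(\<lambda>n. pairing (s n) c) \<longlonglongrightarrow> pairing f c" for c
  proof (induction c)
    case (Cons a c)
    have "(\<lambda>n. cinner (s n (fst a)) (snd a)) \<longlonglongrightarrow> cinner (f (fst a)) (snd a)"
      by (rule tendsto_cinner_left[OF f])
    then show ?case
      using Cons by (simp add: tendsto_add)
  qed simp
  have near: "bounded_by (\<lambda>x. s m x - f x) \<epsilon>"
    if "0 < \<epsilon>" "\<And>n. n \<ge> N \<Longrightarrow> dual_norm (\<lambda>x. s m x - s n x) < \<epsilon>" for m N \<epsilon>
    unfolding bounded_by_def
  proof (intro conjI allI)
    fix c
    show "cmod (pairing (\<lambda>x. s m x - f x) c) \<le> \<epsilon> * sqrt (L.Q c)"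
    proof (rule LIMSEQ_le_const2)
      show "(\<lambda>n. cmod (pairing (\<lambda>x. s m x - s n x) c)) \<longlonglongrightarrow> cmod (pairing (\<lambda>x. s m x - f x) c)"
        unfolding pairing_diff by (intro tendsto_intros lim)
      have "cmod (pairing (\<lambda>x. s m x - s n x) c) \<le> \<epsilon> * sqrt (L.Q c)" if "n \<ge> N" for n
      proof -
        have "dual_norm (\<lambda>x. s m x - s n x) * sqrt (L.Q c) \<le> \<epsilon> * sqrt (L.Q c)"
          using \<open>\<And>n. n \<ge> N \<Longrightarrow> dual_norm (\<lambda>x. s m x - s n x) < \<epsilon>\<close>[OF that] L.Q_nonneg[of c]
          by (intro mult_right_mono) auto
        then show ?thesis
          using pairing_le_dual_norm[OF dual_diff[OF s s], of m n c] by linarith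
      qed
      then show "\<exists>N. \<forall>n\<ge>N. cmod (pairing (\<lambda>x. s m x - s n x) c) \<le> \<epsilon> * sqrt (L.Q c)"
        by blast
    qed
  qed (use that in simp)
  have f_dual: "f \<in> dual"
  proof -
    obtain N where "\<And>m n. m \<ge> N \<Longrightarrow> n \<ge> N \<Longrightarrow> dual_norm (\<lambda>x. s m x - s n x) < 1"
      using cauchy[of 1] by auto
    then have "bounded_by (\<lambda>x. s N x - f x) 1"
      by (intro near) auto
    then have "(\<lambda>x. s N x - f x) \<in> dual"
      by (auto simp: dual_def)
    from dual_diff[OF s[of N] this] show ?thesis
      by simp
  qed
  moreover have "(\<lambda>n. dual_norm (\<lambda>x. s n x - f x)) \<longlonglongrightarrow> 0"
  proof (rule LIMSEQ_I)
    fix r :: real assume "0 < r"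
    then obtain N where N: "\<And>m n. m \<ge> N \<Longrightarrow> n \<ge> N \<Longrightarrow> dual_norm (\<lambda>x. s m x - s n x) < r / 2"
      using cauchy[of "r / 2"] by auto
    have "norm (dual_norm (\<lambda>x. s m x - f x) - 0) < r" if "m \<ge> N" for m
    proof -
      have "dual_norm (\<lambda>x. s m x - f x) \<le> r / 2"
        using N[OF that] \<open>0 < r\<close> by (intro dual_norm_le near) auto
      then show ?thesis
        using dual_norm_nonneg[OF dual_diff[OF s f_dual], of m] \<open>0 < r\<close> by simp
    qed
    then show "\<exists>N. \<forall>n\<ge>N. norm (dual_norm (\<lambda>x. s n x - f x) - 0) < r"
      by blast
  qed
  ultimately show ?thesis
    by blast
qed

definition dual_space :: "('x, 'e) fspace"
  where "dual_space = \<lparr>elems = dual, ip = dual_ip\<rparr>"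

lemma dual_space_sel [simp]: "elems dual_space = dual" "ip dual_space = dual_ip"
    "fnorm dual_space f = dual_norm f"
  by (simp_all add: dual_space_def fnorm_def dual_norm_def)

lemma dual_ip_pos:
  assumes "f \<in> dual" "f \<noteq> (\<lambda>x. 0)"
  shows "0 < Re (dual_ip f f)"
proof (rule ccontr)
  assume "\<not> 0 < Re (dual_ip f f)"
  then have "dual_norm f = 0"
    using dual_norm_nonneg[OF assms(1)] by (simp add: dual_norm_def)
  then have "pairing f c = 0" for c
    using pairing_le_dual_norm[OF assms(1), of c] by simp
  then have "f = (\<lambda>x. 0)"
    by (intro pairing_inject) simp
  then show False
    using assms(2) by blast
qed

lemma hilbert_dual_space: "hilbert_fspace dual_space"
  unfolding hilbert_fspace_def dual_space_sel
proof (intro conjI ballI allI impI)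
  fix f g show "dual_ip f g = cnj (dual_ip g f)"
    by (rule dual_ip_commute)
qed (auto simp: dual_zero dual_add dual_scaleC dual_ip_add_left dual_ip_scaleC_left dual_ip_pos
    intro!: dual_complete)

lemma has_kernel_dual_space: "has_kernel dual_space k"
proof -
  have "(\<lambda>x. k x y *\<^sub>C v) = kfun k [(y, v)]" for y and v :: 'e
    by (simp add: fun_eq_iff)
  then show ?thesis
    using kfun_dual dual_ip_kfun by (simp add: has_kernel_def)
qed

lemma rkhs_eq: "rkhs k = dual_space"
  unfolding rkhs_def
proof (rule the_equality)
  show "hilbert_fspace dual_space \<and> has_kernel dual_space k \<and>
      (\<forall>f g. f \<notin> elems dual_space \<or> g \<notin> elems dual_space \<longrightarrow> ip dual_space f g = 0)"
    using hilbert_dual_space has_kernel_dual_space by (auto simp: dual_ip_def)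
  then show "S = dual_space" if "hilbert_fspace S \<and> has_kernel S k \<and>
      (\<forall>f g. f \<notin> elems S \<or> g \<notin> elems S \<longrightarrow> ip S f g = 0)" for S
    using that by (intro kernel_space_unique) auto
qed

lemma rkhs_kernel_space: "kernel_space (rkhs k :: ('x, 'e) fspace) k"
  using hilbert_dual_space has_kernel_dual_space by (simp add: rkhs_eq kernel_space.intro
      hilbert_function_space.intro kernel_space_axioms.intro)

text \<open>From here on, membership and norm bounds in \<open>rkhs k\<close> are inequalities on
  finite lists, applicable to functions not yet known to lie in the space.\<close>

lemma rkhs_char:
  "f \<in> elems (rkhs k :: ('x, 'e) fspace) \<and> fnorm (rkhs k) f \<le> M \<longleftrightarrow>
    0 \<le> M \<and> (\<forall>c. cmod (pairing f c) \<le> M * sqrt (Re (bform k c c)))"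
  using kernel_space_char[OF hilbert_dual_space has_kernel_dual_space, of f M]
  by (simp add: rkhs_eq bounded_by_def L.Q_def)

end

subsection \<open>Positive semidefinite kernels\<close>

text \<open>Only scalar coefficients occur; vector-valued lists are reduced to this case by
  enlarging the index set. Points may repeat in a list. Symmetry is required separately, as the
  second condition sees only real parts.\<close>

definition psd_on :: "'p set \<Rightarrow> ('p \<Rightarrow> 'p \<Rightarrow> complex) \<Rightarrow> bool"
  where "psd_on S K \<longleftrightarrow> (\<forall>p\<in>S. \<forall>q\<in>S. K p q = cnj (K q p)) \<and>
    (\<forall>c :: ('p \<times> complex) list. fst ` set c \<subseteq> S \<longrightarrow> 0 \<le> Re (bform K c c))"

lemma psd_onI:
  assumes "\<And>p q. p \<in> S \<Longrightarrow> q \<in> S \<Longrightarrow> K p q = cnj (K q p)"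
    and "\<And>c :: ('p \<times> complex) list. fst ` set c \<subseteq> S \<Longrightarrow> 0 \<le> Re (bform K c c)"
  shows "psd_on S K"
  unfolding psd_on_def using assms by blast

lemma psd_on_commute: "psd_on S K \<Longrightarrow> p \<in> S \<Longrightarrow> q \<in> S \<Longrightarrow> K p q = cnj (K q p)"
  unfolding psd_on_def by blast

lemma psd_on_nonneg:
  fixes c :: "('p \<times> complex) list"
  assumes "psd_on S K" "fst ` set c \<subseteq> S"
  shows "0 \<le> Re (bform K c c)"
  using assms(1)[unfolded psd_on_def, THEN conjunct2] assms(2) by blast

lemma psd_on_semi_inner:
  "psd_on S K \<Longrightarrow> semi_inner {c :: ('p \<times> complex) list. fst ` set c \<subseteq> S} (@) lsc (bform K)"
  by (rule semi_inner_bform) (auto intro: psd_on_commute psd_on_nonneg)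

lemma bform_eq:
  "bform K c d = (\<Sum>b\<leftarrow>d. \<Sum>a\<leftarrow>c. K (fst b) (fst a) * cinner (snd a) (snd b))"
proof -
  have "cinner (kfun K c p) w = (\<Sum>a\<leftarrow>c. K p (fst a) * cinner (snd a) w)" for p w
    by (induction c) (auto simp: cinner_add_left cinner_scaleC_left)
  moreover have "pairing f d = (\<Sum>b\<leftarrow>d. cinner (f (fst b)) (snd b))" for f
    by (induction d) auto
  ultimately show ?thesis
    by (simp add: bform_def)
qed

lemma bform_cong:
  assumes "\<And>p q. p \<in> fst ` set d \<Longrightarrow> q \<in> fst ` set c \<Longrightarrow> K p q = L p q"
  shows "bform K c d = bform L c d"
proof -
  have "K (fst b) (fst a) = L (fst b) (fst a)" if "b \<in> set d" "a \<in> set c" for a b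
    using that assms by simp
  then show ?thesis
    unfolding bform_eq by (intro arg_cong[of _ _ sum_list] map_cong refl) simp
qed

lemma bform_map:
  "bform K (map f c) (map g d)
    = (\<Sum>b\<leftarrow>d. \<Sum>a\<leftarrow>c. K (fst (g b)) (fst (f a)) * cinner (snd (f a)) (snd (g b)))"
  by (simp add: bform_eq o_def)

lemma psd_on_cong:
  assumes "psd_on S K" "\<And>p q. p \<in> S \<Longrightarrow> q \<in> S \<Longrightarrow> K p q = L p q"
  shows "psd_on S L"
proof (rule psd_onI)
  show "L p q = cnj (L q p)" if "p \<in> S" "q \<in> S" for p q
    using psd_on_commute[OF assms(1) that] assms(2) that by simp
  show "0 \<le> Re (bform L c c)" if "fst ` set c \<subseteq> S" for c :: "('a \<times> complex) list"
    using psd_on_nonneg[OF assms(1) that] bform_cong[of c c K L] assms(2) that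
    by (metis (no_types, lifting) subsetD)
qed

lemma psd_on_subset: "psd_on S K \<Longrightarrow> T \<subseteq> S \<Longrightarrow> psd_on T K"
proof (rule psd_onI)
  assume K: "psd_on S K" "T \<subseteq> S"
  show "K p q = cnj (K q p)" if "p \<in> T" "q \<in> T" for p q
    by (rule psd_on_commute[OF K(1)]) (use that K(2) in auto)
  show "0 \<le> Re (bform K c c)" if "fst ` set c \<subseteq> T" for c :: "('a \<times> complex) list"
    by (rule psd_on_nonneg[OF K(1)]) (use that K(2) in auto)
qed

lemma bform_add_kernel: "bform (\<lambda>p q. K p q + L p q) c d = bform K c d + bform L c d"
  by (simp add: bform_eq distrib_right sum_list_addf)

lemma bform_diff_kernel: "bform (\<lambda>p q. K p q - L p q) c d = bform K c d - bform L c d"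
  by (simp add: bform_eq left_diff_distrib sum_list_subtractf)

lemma psd_on_add: "psd_on S K \<Longrightarrow> psd_on S L \<Longrightarrow> psd_on S (\<lambda>p q. K p q + L p q)"
proof (rule psd_onI)
  assume KL: "psd_on S K" "psd_on S L"
  show "K p q + L p q = cnj (K q p + L q p)" if "p \<in> S" "q \<in> S" for p q
    using psd_on_commute[OF KL(1) that] psd_on_commute[OF KL(2) that] by simp
  show "0 \<le> Re (bform (\<lambda>p q. K p q + L p q) c c)" if "fst ` set c \<subseteq> S" for c :: "('a \<times> complex) list"
    using psd_on_nonneg[OF KL(1) that] psd_on_nonneg[OF KL(2) that] by (simp add: bform_add_kernel)
qed

text \<open>The weights are absorbed into the coefficients.\<close>

lemma psd_on_rank_one_mult:
  assumes "psd_on S M"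
  shows "psd_on S (\<lambda>p q. r p * cnj (r q) * M p q)"
proof (rule psd_onI)
  show "r p * cnj (r q) * M p q = cnj (r q * cnj (r p) * M q p)" if "p \<in> S" "q \<in> S" for p q
    using psd_on_commute[OF assms that] by simp
  fix c :: "('a \<times> complex) list"
  assume c: "fst ` set c \<subseteq> S"
  let ?c = "map (\<lambda>a. (fst a, cnj (r (fst a)) * snd a)) c"
  have "bform (\<lambda>p q. r p * cnj (r q) * M p q) c c = bform M ?c ?c"
    unfolding bform_map by (simp add: bform_eq cinner_complex mult_ac)
  then show "0 \<le> Re (bform (\<lambda>p q. r p * cnj (r q) * M p q) c c)"
    using psd_on_nonneg[OF assms, of ?c] c by (simp add: image_image)
qed

lemma psd_on_scale:
  assumes "psd_on S M" "0 \<le> a"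
  shows "psd_on S (\<lambda>p q. of_real a * M p q)"
proof -
  have "of_real (sqrt a) * cnj (of_real (sqrt a)) = (of_real a :: complex)"
    using assms(2) by (simp flip: of_real_mult)
  then show ?thesis
    using psd_on_rank_one_mult[OF assms(1), of "\<lambda>_. of_real (sqrt a)"] by simp
qed

text \<open>The vectors move from the coefficients into the kernel. This trades vector-valued lists
  for scalar lists over a larger index set.\<close>

lemma bform_expand:
  "bform k (map (\<lambda>a. (x (fst a), snd a *\<^sub>C v (fst a))) c) (map (\<lambda>a. (x (fst a), snd a *\<^sub>C v (fst a))) d)
    = bform (\<lambda>p q. k (x p) (x q) * cinner (v q) (v p)) c (d :: ('p \<times> complex) list)"
  unfolding bform_map
  by (simp add: bform_eq cinner_complex cinner_scaleC_left cinner_scaleC_right mult_ac)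

lemma bform_const_one: "bform (\<lambda>_ _. 1) c d = cinner (\<Sum>a\<leftarrow>c. snd a) (\<Sum>b\<leftarrow>d. snd b)"
proof -
  have "kfun (\<lambda>_ _. 1) c = (\<lambda>x :: 'a. \<Sum>a\<leftarrow>c. snd a)"
    by (induction c) (auto simp: fun_eq_iff)
  moreover have "pairing (\<lambda>_. s) d = cinner s (\<Sum>b\<leftarrow>d. snd b)" for s
    by (induction d) (auto simp: cinner_add_right)
  ultimately show ?thesis
    by (simp add: bform_def)
qed

lemma psd_on_gram: "psd_on S (\<lambda>p q. cinner (v q) (v p :: 'e::chilbert_space))"
proof (rule psd_onI)
  show "cinner (v q) (v p) = cnj (cinner (v p) (v q))" for p q
    by (rule cinner_commute)
  show "0 \<le> Re (bform (\<lambda>p q. cinner (v q) (v p)) c c)" for c :: "('a \<times> complex) list"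
  proof -
    \<comment> \<open>All points are collapsed to one, where the constant kernel returns the squared
      norm of the summed vectors.\<close>
    let ?c = "map (\<lambda>a. ((), snd a *\<^sub>C v (fst a))) c"
    have "bform (\<lambda>p q. 1 * cinner (v q) (v p)) c c = bform (\<lambda>_ _. 1) ?c ?c"
      by (rule bform_expand[symmetric])
    then show ?thesis
      by (simp add: bform_const_one Re_cinner_self)
  qed
qed

lemma psd_on_one: "psd_on S (\<lambda>p q. 1)"
  using psd_on_gram[of S "\<lambda>_. 1 :: complex"] by (simp add: cinner_complex)

lemma has_sum_sum_list:
  fixes f :: "'a \<Rightarrow> 'i \<Rightarrow> 'b::topological_comm_monoid_add"
  assumes "\<And>a. a \<in> set xs \<Longrightarrow> (f a has_sum s a) I"
  shows "((\<lambda>i. \<Sum>a\<leftarrow>xs. f a i) has_sum (\<Sum>a\<leftarrow>xs. s a)) I"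
  using assms by (induction xs) (auto intro!: has_sum_add)

lemma tendsto_sum_list:
  fixes f :: "'a \<Rightarrow> 'i \<Rightarrow> 'b::topological_comm_monoid_add"
  assumes "\<And>a. a \<in> set xs \<Longrightarrow> (f a \<longlongrightarrow> s a) F"
  shows "((\<lambda>i. \<Sum>a\<leftarrow>xs. f a i) \<longlongrightarrow> (\<Sum>a\<leftarrow>xs. s a)) F"
  using assms by (induction xs) (auto intro!: tendsto_add)

lemma psd_on_limit:
  assumes "\<And>n. psd_on S (K n)" "\<And>p q. p \<in> S \<Longrightarrow> q \<in> S \<Longrightarrow> (\<lambda>n. K n p q) \<longlonglongrightarrow> L p q"
  shows "psd_on S L"
proof (rule psd_onI)
  fix p q assume pq: "p \<in> S" "q \<in> S"
  have "(\<lambda>n. K n p q) \<longlonglongrightarrow> cnj (L q p)"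
    using tendsto_cnj[OF assms(2)[OF pq(2,1)]] psd_on_commute[OF assms(1) pq] by simp
  then show "L p q = cnj (L q p)"
    using assms(2)[OF pq] LIMSEQ_unique by blast
next
  fix c :: "('a \<times> complex) list"
  assume c: "fst ` set c \<subseteq> S"
  have "(\<lambda>n. bform (K n) c c) \<longlonglongrightarrow> bform L c c"
    unfolding bform_eq using c
    by (intro tendsto_sum_list tendsto_mult_right assms(2)) auto
  then have "(\<lambda>n. Re (bform (K n) c c)) \<longlonglongrightarrow> Re (bform L c c)"
    by (rule tendsto_Re)
  then show "0 \<le> Re (bform L c c)"
    by (rule LIMSEQ_le_const) (use assms(1) c psd_on_nonneg in blast)
qed

lemma psd_on_cauchy_schwarz:
  assumes "psd_on S K" "p \<in> S" "q \<in> S"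
  shows "(cmod (K p q))\<^sup>2 \<le> Re (K p p) * Re (K q q)"
proof -
  interpret semi_inner "{c :: ('a \<times> complex) list. fst ` set c \<subseteq> S}" "(@)" lsc "bform K"
    by (rule psd_on_semi_inner[OF assms(1)])
  show ?thesis
    using cauchy_schwarz_sq[of "[(q, 1)]" "[(p, 1)]"] assms(2,3)
    by (simp add: Q_def bform_eq cinner_complex mult.commute)
qed

text \<open>Entries at \<open>z\<close> contribute nothing to the form and can be filtered out. The
  Pick factor creates such a null point below.\<close>

lemma psd_on_insert_null:
  assumes "psd_on S K" and null: "\<And>q. K z q = 0" "\<And>q. K q z = 0"
  shows "psd_on (insert z S) K"
proof (rule psd_onI)
  show "K p q = cnj (K q p)" if "p \<in> insert z S" "q \<in> insert z S" for p q
    using that psd_on_commute[OF assms(1), of p q] null by (cases "p = z"; cases "q = z") auto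
  fix c :: "('a \<times> complex) list"
  assume c: "fst ` set c \<subseteq> insert z S"
  let ?c = "filter (\<lambda>a. fst a \<noteq> z) c"
  have "kfun K ?c = kfun K c"
  proof
    show "kfun K ?c x = kfun K c x" for x
      by (induction c) (auto simp: null)
  qed
  moreover have "pairing f ?c = pairing f c" if "f z = 0" for f :: "'a \<Rightarrow> complex"
    using that by (induction c) auto
  moreover have "kfun K c z = 0"
    by (induction c) (auto simp: null)
  ultimately have "bform K ?c ?c = bform K c c"
    by (simp add: bform_def)
  moreover have "fst ` set ?c \<subseteq> S"
    using c by auto
  ultimately show "0 \<le> Re (bform K c c)"
    using psd_on_nonneg[OF assms(1)] by metis
qed

subsection \<open>Products with Gram kernels of square summable families\<close>

lemma ell2_has_sum:
  assumes "v \<in> ell2" "w \<in> ell2"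
  shows "((\<lambda>i. v i * cnj (w i)) has_sum ell2_inner v w) UNIV"
proof -
  have "(\<lambda>i. (cmod (v i))\<^sup>2 + (cmod (w i))\<^sup>2) summable_on UNIV"
    using assms by (intro summable_on_add) (auto simp: ell2_def)
  then have "(\<lambda>i. norm (v i * cnj (w i))) summable_on UNIV"
  proof (rule summable_on_comparison_test)
    fix i
    have "0 \<le> (cmod (v i) - cmod (w i))\<^sup>2"
      by simp
    moreover have "0 \<le> cmod (v i) * cmod (w i)"
      by simp
    ultimately show "norm (v i * cnj (w i)) \<le> (cmod (v i))\<^sup>2 + (cmod (w i))\<^sup>2"
      unfolding power2_diff norm_mult complex_mod_cnj by linarith
  qed simp
  then show ?thesis
    unfolding ell2_inner_def by (rule has_sum_infsum[OF abs_summable_summable])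
qed

text \<open>A Schur product: the Gram kernel is a sum of rank-one kernels, one per coordinate, and
  each of them preserves positivity of \<open>M\<close>. The sum over coordinates may be infinite,
  the list is finite.\<close>

lemma psd_on_ell2_mult:
  assumes M: "psd_on S M" and d: "\<And>p. p \<in> S \<Longrightarrow> d p \<in> ell2"
  shows "psd_on S (\<lambda>p q. M p q * ell2_inner (d p) (d q))"
proof (rule psd_onI)
  fix p q assume pq: "p \<in> S" "q \<in> S"
  have "((\<lambda>i. cnj (d q i * cnj (d p i))) has_sum cnj (ell2_inner (d q) (d p))) UNIV"
    using ell2_has_sum[OF d[OF pq(2)] d[OF pq(1)]] by (simp only: has_sum_cnj_iff)
  then have "((\<lambda>i. d p i * cnj (d q i)) has_sum cnj (ell2_inner (d q) (d p))) UNIV"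
    by (simp add: mult.commute)
  then have "ell2_inner (d p) (d q) = cnj (ell2_inner (d q) (d p))"
    by (rule has_sum_unique[OF ell2_has_sum[OF d[OF pq(1)] d[OF pq(2)]]])
  then show "M p q * ell2_inner (d p) (d q) = cnj (M q p * ell2_inner (d q) (d p))"
    using psd_on_commute[OF M pq] by simp
next
  fix c :: "('a \<times> complex) list"
  assume c: "fst ` set c \<subseteq> S"
  have "((\<lambda>i. bform (\<lambda>p q. d p i * cnj (d q i) * M p q) c c) has_sum
      bform (\<lambda>p q. ell2_inner (d p) (d q) * M p q) c c) UNIV"
    unfolding bform_eq using c d
    by (intro has_sum_sum_list has_sum_cmult_left ell2_has_sum) auto
  from has_sum_Re[OF this] have "0 \<le> Re (bform (\<lambda>p q. ell2_inner (d p) (d q) * M p q) c c)"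
  proof (rule has_sum_nonneg)
    show "0 \<le> Re (bform (\<lambda>p q. d p i * cnj (d q i) * M p q) c c)" for i
      by (rule psd_on_nonneg[OF psd_on_rank_one_mult[OF M] c])
  qed
  then show "0 \<le> Re (bform (\<lambda>p q. M p q * ell2_inner (d p) (d q)) c c)"
    by (simp add: mult.commute)
qed

lemma ell2_inner_self: "v \<in> ell2 \<Longrightarrow> ell2_inner v v = of_real ((ell2_norm v)\<^sup>2)"
proof -
  assume v: "v \<in> ell2"
  have "((\<lambda>i. (cmod (v i))\<^sup>2) has_sum (\<Sum>\<^sub>\<infinity>i. (cmod (v i))\<^sup>2)) UNIV"
    using v by (auto simp: ell2_def)
  then have "((\<lambda>i. of_real ((cmod (v i))\<^sup>2) :: complex) has_sum of_real (\<Sum>\<^sub>\<infinity>i. (cmod (v i))\<^sup>2)) UNIV"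
    by (simp only: has_sum_of_real_iff)
  then have "ell2_inner v v = of_real (\<Sum>\<^sub>\<infinity>i. (cmod (v i))\<^sup>2)"
    using ell2_has_sum[OF v v] by (simp add: complex_norm_square[symmetric] has_sum_unique)
  moreover have "0 \<le> (\<Sum>\<^sub>\<infinity>i. (cmod (v i))\<^sup>2)"
    by (rule infsum_nonneg) simp
  ultimately show ?thesis
    by (simp add: ell2_norm_def)
qed

lemma psd_on_ell2: "(\<And>p. p \<in> S \<Longrightarrow> d p \<in> ell2) \<Longrightarrow> psd_on S (\<lambda>p q. ell2_inner (d p) (d q))"
  using psd_on_ell2_mult[OF psd_on_one, of S d] by simp

lemma ell2_diff:
  assumes "v \<in> ell2" "w \<in> ell2"
  shows "(\<lambda>i. v i - w i) \<in> ell2"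
proof -
  have "(\<lambda>i. 2 * ((cmod (v i))\<^sup>2 + (cmod (w i))\<^sup>2)) summable_on UNIV"
    using assms by (intro summable_on_cmult_right summable_on_add) (auto simp: ell2_def)
  then have "(\<lambda>i. (cmod (v i - w i))\<^sup>2) summable_on UNIV"
  proof (rule summable_on_comparison_test)
    fix i
    have "(cmod (v i - w i))\<^sup>2 \<le> (cmod (v i) + cmod (w i))\<^sup>2"
      by (intro power_mono norm_triangle_ineq4) simp
    also have "\<dots> \<le> 2 * ((cmod (v i))\<^sup>2 + (cmod (w i))\<^sup>2)"
      using zero_le_power2[of "cmod (v i) - cmod (w i)"] unfolding power2_diff power2_sum by simp
    finally show "(cmod (v i - w i))\<^sup>2 \<le> 2 * ((cmod (v i))\<^sup>2 + (cmod (w i))\<^sup>2)" .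
  qed simp
  then show ?thesis
    by (simp add: ell2_def)
qed

lemma ell2_inner_diff:
  assumes "v \<in> ell2" "w \<in> ell2" "l \<in> ell2"
  shows "ell2_inner (\<lambda>i. v i - w i) l = ell2_inner v l - ell2_inner w l"
    "ell2_inner l (\<lambda>i. v i - w i) = ell2_inner l v - ell2_inner l w"
proof -
  have "((\<lambda>i. v i * cnj (l i) + (-1) * (w i * cnj (l i))) has_sum
      ell2_inner v l + (-1) * ell2_inner w l) UNIV"
    using assms by (intro has_sum_add has_sum_cmult_right ell2_has_sum)
  then have "((\<lambda>i. (v i - w i) * cnj (l i)) has_sum ell2_inner v l - ell2_inner w l) UNIV"
    by (simp add: algebra_simps)
  then show "ell2_inner (\<lambda>i. v i - w i) l = ell2_inner v l - ell2_inner w l"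
    by (rule has_sum_unique[OF ell2_has_sum[OF ell2_diff[OF assms(1,2)] assms(3)]])
  have "((\<lambda>i. l i * cnj (v i) + (-1) * (l i * cnj (w i))) has_sum
      ell2_inner l v + (-1) * ell2_inner l w) UNIV"
    using assms by (intro has_sum_add has_sum_cmult_right ell2_has_sum)
  then have "((\<lambda>i. l i * cnj (v i - w i)) has_sum ell2_inner l v - ell2_inner l w) UNIV"
    by (simp add: algebra_simps)
  then show "ell2_inner l (\<lambda>i. v i - w i) = ell2_inner l v - ell2_inner l w"
    by (rule has_sum_unique[OF ell2_has_sum[OF assms(3) ell2_diff[OF assms(1,2)]]])
qed

section \<open>CNP kernels: positivity and the complete Pick property\<close>

locale cnp =
  fixes u :: "'x \<Rightarrow> 'i \<Rightarrow> complex" and k :: "'x \<Rightarrow> 'x \<Rightarrow> complex"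
  assumes cnp: "cnp_kernel u k"
begin

lemma u_ell2 [simp]: "u x \<in> ell2"
  using cnp by (simp add: cnp_kernel_def)

lemma u_less: "(ell2_norm (u x))\<^sup>2 < 1"
proof -
  have "0 \<le> ell2_norm (u x)"
    by (simp add: ell2_norm_def infsum_nonneg)
  then show ?thesis
    using cnp by (simp add: cnp_kernel_def abs_square_less_1)
qed

abbreviation g :: "'x \<Rightarrow> 'x \<Rightarrow> complex" where "g x y \<equiv> ell2_inner (u x) (u y)"

lemma k_eq: "k x y = 1 / (1 - g x y)"
  using cnp by (simp add: cnp_kernel_def)

lemma g_less: "cmod (g x y) < 1"
proof -
  have "(cmod (g x y))\<^sup>2 \<le> (ell2_norm (u x))\<^sup>2 * (ell2_norm (u y))\<^sup>2"
    using psd_on_cauchy_schwarz[OF psd_on_ell2, of UNIV u x y] by (simp add: ell2_inner_self)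
  also have "\<dots> < 1"
    using u_less[of x] u_less[of y] by (smt (verit) mult_left_le zero_le_power2)
  finally show ?thesis
    by (simp add: abs_square_less_1)
qed

lemma g_neq_1: "g x y \<noteq> 1"
  using g_less[of x y] by auto

lemma k_nonzero: "k x y \<noteq> 0"
  using g_neq_1 by (simp add: k_eq)

lemma g_commute: "g x y = cnj (g y x)"
  using psd_on_commute[OF psd_on_ell2, of UNIV u x y] by simp

lemma k_commute: "k x y = cnj (k y x)"
  using g_commute[of x y] by (simp add: k_eq)

text \<open>\<open>k\<close> is the geometric series in \<open>g\<close>, whose powers are handled
  by repeated Schur products. The map \<open>x\<close> lets \<open>M\<close> live on richer indices,
  such as point-vector pairs.\<close>

lemma psd_on_k_mult:
  assumes "psd_on S M"
  shows "psd_on S (\<lambda>p q. M p q * k (x p) (x q))"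
proof (rule psd_on_limit)
  have 1: "psd_on S (\<lambda>p q. M p q * g (x p) (x q) ^ n)" for n
  proof (induction n)
    case (Suc n)
    have "psd_on S (\<lambda>p q. M p q * g (x p) (x q) ^ n * g (x p) (x q))"
      by (rule psd_on_ell2_mult[OF Suc]) simp
    then show ?case
      by (simp add: mult_ac)
  qed (use assms in simp)
  show "psd_on S (\<lambda>p q. M p q * (\<Sum>n<N. g (x p) (x q) ^ n))" for N
  proof (induction N)
    case 0
    show ?case
      using psd_on_scale[OF assms, of 0] by simp
  next
    case (Suc N)
    show ?case
      using psd_on_add[OF Suc 1[of N]] by (simp add: distrib_left)
  qed
  have "(\<lambda>N. \<Sum>n<N. g x y ^ n) \<longlonglongrightarrow> k x y" for x y
    using geometric_sums[OF g_less] by (simp add: sums_def k_eq)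
  then show "(\<lambda>N. M p q * (\<Sum>n<N. g (x p) (x q) ^ n)) \<longlonglongrightarrow> M p q * k (x p) (x q)" for p q
    by (intro tendsto_mult_left)
qed

lemma psd_on_k_gram: "psd_on S (\<lambda>p q. k (x p) (x q) * cinner (v q) (v p :: 'e::chilbert_space))"
  using psd_on_k_mult[OF psd_on_gram, of S v x] by (simp add: mult.commute)

lemma positive_kernel: "positive_kernel TYPE('e::chilbert_space) k"
proof
  show "k x y = cnj (k y x)" for x y
    by (rule k_commute)
  fix c :: "('x \<times> 'e) list"
  \<comment> \<open>Each entry of the list becomes an index of its own, with coefficient 1.\<close>
  have "bform k c c = bform (\<lambda>p q. k (fst p) (fst q) * cinner (snd q) (snd p))
      (map (\<lambda>p. (p, 1 :: complex)) c) (map (\<lambda>p. (p, 1)) c)"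
    using bform_expand[of k fst snd "map (\<lambda>p. (p, 1)) c" "map (\<lambda>p. (p, 1)) c"]
    by (simp add: o_def)
  then show "0 \<le> Re (bform k c c)"
    using psd_on_nonneg[OF psd_on_k_gram, of _ UNIV] by simp
qed

lemma k_pos: "0 < Re (k x x)" "Im (k x x) = 0"
proof -
  have "k x x = of_real (1 / (1 - (ell2_norm (u x))\<^sup>2))"
    by (simp add: k_eq ell2_inner_self)
  then show "0 < Re (k x x)" "Im (k x x) = 0"
    using u_less[of x] by (simp_all only: Re_complex_of_real Im_complex_of_real) simp
qed

text \<open>The quotient by k(x,y) of k(x,y) - k(x,z) k(z,y) / k(z,z), the kernel of the functions
  vanishing at z. Its positivity is the McCullough-Quiggin form of the complete Pick
  property.\<close>

definition pick :: "'x \<Rightarrow> 'x \<Rightarrow> 'x \<Rightarrow> complex"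
  where "pick z x y = 1 - k x z * k z y / (k z z * k x y)"

lemma pick_null: "pick z z y = 0" "pick z x z = 0"
  using k_nonzero by (simp_all add: pick_def)

text \<open>Clearing denominators, this expands
  \<open>(1 - \<langle>u(x),u(z)\<rangle>)(1 - \<langle>u(z),u(y)\<rangle>) - (1 - \<parallel>u(z)\<parallel>\<^sup>2)(1 - \<langle>u(x),u(y)\<rangle>)\<close> in terms of
  \<open>d(x) = u(x) - u(z)\<close>; both summands on the right are positive kernels.\<close>

lemma pick_eq:
  fixes z defines "d \<equiv> \<lambda>x i. u x i - u z i"
  shows "pick z x y = (1 / (1 - g x z)) * cnj (1 / (1 - g y z)) *
    (of_real (1 - (ell2_norm (u z))\<^sup>2) * ell2_inner (d x) (d y)
      + ell2_inner (d x) (u z) * cnj (ell2_inner (d y) (u z)))"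
proof -
  have r: "of_real (1 - (ell2_norm (u z))\<^sup>2) = 1 - g z z"
    by (simp add: ell2_inner_self)
  have [simp]: "cnj (g y z) = g z y"
    by (rule g_commute[symmetric])
  have zz: "cnj (g z z) = g z z"
    by (rule g_commute[symmetric])
  show ?thesis
    unfolding r unfolding d_def pick_def k_eq
    by (simp add: ell2_inner_diff ell2_diff g_neq_1 zz divide_simps) (simp add: algebra_simps)
qed

text \<open>In \<open>pick_eq\<close> the bracket is a Gram kernel with a nonnegative factor plus a
  rank-one kernel, and the denominators are one more rank-one weight.\<close>

lemma psd_on_pick_mult:
  assumes M: "psd_on S M"
  shows "psd_on S (\<lambda>p q. M p q * pick z (x p) (x q))"
proof -
  define d where "d = (\<lambda>y i. u y i - u z i)"
  have d [simp]: "d y \<in> ell2" for y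
    by (simp add: d_def ell2_diff)
  have "psd_on S (\<lambda>p q. of_real (1 - (ell2_norm (u z))\<^sup>2) * (M p q * ell2_inner (d (x p)) (d (x q)))
      + ell2_inner (d (x p)) (u z) * cnj (ell2_inner (d (x q)) (u z)) * M p q)"
    using u_less[of z] by (intro psd_on_add psd_on_scale psd_on_ell2_mult psd_on_rank_one_mult M) auto
  then have "psd_on S (\<lambda>p q. 1 / (1 - g (x p) z) * cnj (1 / (1 - g (x q) z)) *
      (of_real (1 - (ell2_norm (u z))\<^sup>2) * (M p q * ell2_inner (d (x p)) (d (x q)))
      + ell2_inner (d (x p)) (u z) * cnj (ell2_inner (d (x q)) (u z)) * M p q))"
    by (rule psd_on_rank_one_mult)
  then show ?thesis
    unfolding pick_eq d_def by (rule psd_on_cong) (simp add: algebra_simps)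
qed

end

section \<open>Domination of kernels and contractive containment\<close>

lemma psd_positive_kernel:
  assumes "psd_on UNIV K"
  shows "positive_kernel TYPE(complex) K"
  by unfold_locales (rule psd_on_commute[OF assms] psd_on_nonneg[OF assms]; simp)+

text \<open>Aronszajn's inclusion theorem: a larger Gram form only weakens the inequality in
  \<open>rkhs_char\<close>.\<close>

lemma contractively_contained_rkhs:
  assumes "psd_on UNIV K" "psd_on UNIV (\<lambda>x y. L x y - K x y)"
  shows "contractively_contained (rkhs K) (rkhs L :: ('x, complex) fspace)"
proof -
  have L: "psd_on UNIV L"
    using psd_on_add[OF assms] by simp
  interpret K: positive_kernel K "TYPE(complex)"
    by (rule psd_positive_kernel[OF assms(1)])
  interpret L: positive_kernel L "TYPE(complex)"
    by (rule psd_positive_kernel[OF L])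
  have "f \<in> elems (rkhs L) \<and> fnorm (rkhs L) f \<le> fnorm (rkhs K) f" if "f \<in> elems (rkhs K)" for f :: "'x \<Rightarrow> complex"
  proof -
    have f: "0 \<le> fnorm (rkhs K) f"
      "\<And>c. cmod (pairing f c) \<le> fnorm (rkhs K) f * sqrt (Re (bform K c c))"
      using K.rkhs_char[of f "fnorm (rkhs K) f"] that by auto
    have "cmod (pairing f c) \<le> fnorm (rkhs K) f * sqrt (Re (bform L c c))" for c
    proof -
      have "Re (bform K c c) \<le> Re (bform L c c)"
        using psd_on_nonneg[OF assms(2), of c] by (simp add: bform_diff_kernel)
      then have "fnorm (rkhs K) f * sqrt (Re (bform K c c)) \<le> fnorm (rkhs K) f * sqrt (Re (bform L c c))"
        using f(1) by (intro mult_left_mono) auto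
      then show ?thesis
        using f(2)[of c] by linarith
    qed
    then show ?thesis
      using L.rkhs_char f(1) by blast
  qed
  then show ?thesis
    by (auto simp: contractively_contained_def)
qed

subsection \<open>Leech factorization\<close>

text \<open>The linear extension of f to formal combinations; unlike \<open>pairing\<close> it is
  linear in the coefficients.\<close>

definition lsum :: "('p \<Rightarrow> complex) \<Rightarrow> ('p \<times> complex) list \<Rightarrow> complex"
  where "lsum f c = (\<Sum>a\<leftarrow>c. snd a * f (fst a))"

lemma lsum_simps [simp]:
  "lsum f [] = 0"
  "lsum f (a # c) = snd a * f (fst a) + lsum f c"
  "lsum f (c @ d) = lsum f c + lsum f d"
  "lsum f (lsc z c) = z * lsum f c"
  by (simp_all add: lsum_def) (induction c, auto simp: scaleC_complex algebra_simps)

text \<open>The form depends on a list only through its values under \<open>lsum\<close>, so lists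
  that agree under every \<open>lsum f\<close> are interchangeable without a quotient.\<close>

lemma bform_lsum: "bform K c d = cnj (lsum (\<lambda>p. cnj (lsum (K p) c)) d)"
proof -
  have "kfun K c = (\<lambda>p. lsum (K p) c)"
    by (induction c) (auto simp: fun_eq_iff scaleC_complex)
  moreover have "pairing f d = cnj (lsum (\<lambda>p. cnj (f p)) d)" for f
    by (induction d) (auto simp: cinner_complex)
  ultimately show ?thesis
    by (simp add: bform_def)
qed

lemma bform_rank_one: "bform (\<lambda>p q. f q * cnj (f p)) c d = lsum f c * cnj (lsum f d)"
proof -
  have 1: "lsum (\<lambda>q. f q * y) c = lsum f c * y" for y and c
    by (induction c) (auto simp: algebra_simps)
  have "lsum (\<lambda>p. cnj (lsum f c) * f p) d = cnj (lsum f c) * lsum f d"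
    by (induction d) (auto simp: algebra_simps)
  then show ?thesis
    by (simp add: bform_lsum 1)
qed

text \<open>Collects the occurrences of \<open>z\<close>, possibly several, into one
  coefficient.\<close>

lemma lsum_split:
  assumes "fst ` set c \<subseteq> insert z S"
  shows "\<exists>\<alpha> u. fst ` set u \<subseteq> S \<and> (\<forall>f. lsum f c = \<alpha> * f z + lsum f u)"
  using assms
proof (induction c)
  case Nil
  show ?case
    by (rule exI[of _ 0], rule exI[of _ "[]"]) simp
next
  case (Cons a c)
  then obtain \<alpha> u where IH: "fst ` set u \<subseteq> S" "\<And>f. lsum f c = \<alpha> * f z + lsum f u"
    by auto
  show ?case
  proof (cases "fst a = z")
    case True
    then show ?thesis
      using IH by (intro exI[of _ "\<alpha> + snd a"] exI[of _ u]) (simp add: algebra_simps)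
  next
    case False
    then show ?thesis
      using IH Cons.prems by (intro exI[of _ \<alpha>] exI[of _ "a # u"]) auto
  qed
qed

lemma psd_on_pullback:
  assumes "psd_on (range \<phi>) K"
  shows "psd_on UNIV (\<lambda>p q. K (\<phi> p) (\<phi> q))"
proof (rule psd_onI)
  show "K (\<phi> p) (\<phi> q) = cnj (K (\<phi> q) (\<phi> p))" for p q
    by (rule psd_on_commute[OF assms]) auto
  fix c :: "('b \<times> complex) list"
  let ?c = "map (\<lambda>a. (\<phi> (fst a), snd a)) c"
  have "bform (\<lambda>p q. K (\<phi> p) (\<phi> q)) c c = bform K ?c ?c"
    unfolding bform_map by (simp add: bform_eq)
  moreover have "0 \<le> Re (bform K ?c ?c)"
    by (rule psd_on_nonneg[OF assms]) auto
  ultimately show "0 \<le> Re (bform (\<lambda>p q. K (\<phi> p) (\<phi> q)) c c)"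
    by simp
qed

section \<open>Riesz representation and orthogonal projection\<close>

lemma riesz_representation:
  fixes f :: "'e::chilbert_space \<Rightarrow> complex"
  assumes add: "\<And>v w. f (v + w) = f v + f w" and scale: "\<And>z v. f (z *\<^sub>C v) = z * f v"
    and bound: "\<And>v. cmod (f v) \<le> M * norm v"
  shows "\<exists>w. \<forall>v. f v = cinner v w"
proof -
  interpret semi_inner UNIV "(+)" "(*\<^sub>C)" "cinner :: 'e \<Rightarrow> 'e \<Rightarrow> complex"
    by (rule semi_inner_cinner)
  have Q: "sqrt (Q v) = norm v" for v
    by (simp add: Q_def Re_cinner_self)
  \<comment> \<open>The conjugate appears because \<open>riesz_approx\<close> represents functionals
    through the first slot of the inner product.\<close>
  have "\<exists>c. \<forall>n. c n \<in> UNIV \<and> (\<forall>e\<in>UNIV.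
      cmod (cnj (f e) - cinner (c n) e) \<le> inverse (real (Suc n)) * sqrt (Q e))"
    by (rule riesz_approx[of _ M]) (auto simp: add scale bound Q)
  then obtain c where c: "\<And>n e. cmod (cnj (f e) - cinner (c n) e) \<le> inverse (real (Suc n)) * sqrt (Q e)"
    by blast
  have "Cauchy c"
  proof (rule Cauchy_if_inverse_bound[where K = 1])
    fix m n
    have "sqrt (Q (sub (c m) (c n))) \<le> inverse (real (Suc m)) + inverse (real (Suc n))"
      by (rule approx_cauchy[where \<phi> = "\<lambda>e. cnj (f e)"]) (rule UNIV_I c)+
    then show "dist (c m) (c n) \<le> 1 * (inverse (real (Suc m)) + inverse (real (Suc n)))"
      by (simp add: Q sub_def scaleC_minus_one dist_norm del: of_nat_Suc)
  qed
  then obtain w where w: "c \<longlonglongrightarrow> w"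
    using Cauchy_convergent convergent_def by blast
  have "f v = cinner v w" for v
  proof -
    have "(\<lambda>n. cinner (c n) v) \<longlonglongrightarrow> cnj (f v)"
      by (rule approx_tendsto[where \<phi> = "\<lambda>e. cnj (f e)"]) (rule UNIV_I c)+
    then have "cnj (f v) = cinner w v"
      using tendsto_cinner_left[OF w] LIMSEQ_unique by blast
    then show ?thesis
      using cinner_commute[of v w] by (metis complex_cnj_cnj)
  qed
  then show ?thesis
    by blast
qed

text \<open>Closedness is asked for weak limits, which is what \<open>limit_exists\<close> supplies
  and what subspaces cut out by pointwise conditions satisfy.\<close>

lemma (in hilbert_function_space) projection:
  assumes N: "N \<subseteq> elems S" "(\<lambda>x. 0) \<in> N"
      "\<And>f g. f \<in> N \<Longrightarrow> g \<in> N \<Longrightarrow> (\<lambda>x. f x + g x) \<in> N" "\<And>f z. f \<in> N \<Longrightarrow> (\<lambda>x. z *\<^sub>C f x) \<in> N"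
    and closed: "\<And>s P. (\<And>n::nat. s n \<in> N) \<Longrightarrow> P \<in> elems S \<Longrightarrow>
      (\<And>e. e \<in> elems S \<Longrightarrow> (\<lambda>n. ip S (s n) e) \<longlonglongrightarrow> ip S P e) \<Longrightarrow> P \<in> N"
    and F: "F \<in> elems S"
  shows "\<exists>P\<in>N. \<forall>G\<in>N. ip S F G = ip S P G"
proof -
  have inS: "f \<in> elems S" if "f \<in> N" for f
    using N(1) that by blast
  interpret N: semi_inner N "\<lambda>f g x. f x + g x" "\<lambda>z f x. z *\<^sub>C f x" "ip S"
    by (rule subspace_semi_inner) (use N in auto)
  have "\<exists>c. \<forall>n. c n \<in> N \<and> (\<forall>e\<in>N.
      cmod (ip S F e - ip S (c n) e) \<le> inverse (real (Suc n)) * sqrt (Q e))"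
    by (rule N.riesz_approx[of _ "sqrt (Q F)"])
      (simp_all add: inS F ip_add_right ip_sc_right cauchy_schwarz)
  then obtain c where c: "\<And>n. c n \<in> N"
    and approx: "\<And>n e. e \<in> N \<Longrightarrow> cmod (ip S F e - ip S (c n) e) \<le> inverse (real (Suc n)) * sqrt (Q e)"
    by blast
  obtain P where P: "P \<in> elems S" and lim: "\<And>e. e \<in> elems S \<Longrightarrow> (\<lambda>n. ip S (c n) e) \<longlonglongrightarrow> ip S P e"
    using limit_exists[of c, OF inS[OF c] N.approx_cauchy[of c, OF c approx]] by blast
  have "P \<in> N"
    by (rule closed[of c, OF c P lim])
  moreover have "ip S F G = ip S P G" if "G \<in> N" for G
    using N.approx_tendsto[of c, OF c approx that] lim[OF inS[OF that]] LIMSEQ_unique by blast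
  ultimately show ?thesis
    by blast
qed

section \<open>Extending a contractive prescription to all vectors\<close>

context cnp
begin

text \<open>A triple \<open>(x, e, t)\<close> prescribes \<open>M\<^sub>\<Phi>\<^sup>* (k\<^sub>x \<otimes> e) = t k\<^sub>x\<close>, that is \<open>\<langle>e, \<Phi>(x)\<rangle> = t\<close>, and
  positivity of \<open>leech\<close> on a set of triples says that this prescription is contractive.\<close>

definition leech :: "'x \<times> 'e::chilbert_space \<times> complex \<Rightarrow> 'x \<times> 'e \<times> complex \<Rightarrow> complex"
  where "leech p q = k (fst p) (fst q) *
    (cinner (fst (snd q)) (fst (snd p)) - snd (snd q) * cnj (snd (snd p)))"

text \<open>The two kinds of lists are a combination of the k_x tensor e and its prescribed image,
  so the form compares their inner products.\<close>

lemma bform_leech: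
  "bform leech c d =
    bform k (map (\<lambda>a. (fst (fst a), snd a *\<^sub>C fst (snd (fst a)))) c)
      (map (\<lambda>a. (fst (fst a), snd a *\<^sub>C fst (snd (fst a)))) d)
    - bform k (map (\<lambda>a. (fst (fst a), snd a *\<^sub>C snd (snd (fst a)))) c)
      (map (\<lambda>a. (fst (fst a), snd a *\<^sub>C snd (snd (fst a)))) d)"
  unfolding bform_expand[of k fst "\<lambda>p. fst (snd p)" c d] bform_expand[of k fst "\<lambda>p. snd (snd p)" c d]
    bform_diff_kernel[symmetric]
  by (intro bform_cong) (simp add: leech_def cinner_complex algebra_simps)

lemma leech_commute: "leech p q = cnj (leech q p)"
  using k_commute[of "fst p" "fst q"] cinner_commute[of "fst (snd q)" "fst (snd p)"]
  by (simp add: leech_def)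

text \<open>The unknown value \<open>t\<close> only enters through the component of \<open>t k\<^sub>z\<close> along \<open>k\<^sub>z\<close>. Splitting off
  this component leaves a kernel \<open>r\<close> that does not involve \<open>t\<close> and is positive by the Pick property;
  what remains is to extend the functional \<open>l\<close> to one further vector.\<close>

lemma leech_step:
  fixes e :: "'e::chilbert_space"
  assumes S: "psd_on S (leech :: 'x \<times> 'e \<times> complex \<Rightarrow> _)"
  shows "\<exists>t. psd_on (insert (z, e, t) S) leech"
proof -
  define w where "w = sqrt (Re (k z z))"
  have w: "0 < w" "k z z = of_real w * of_real w"
    using k_pos[of z] by (auto simp: w_def complex_eq_iff)
  have ck: "cnj (k x y) = k y x" for x y
    by (rule k_commute[symmetric])
  define r :: "'x \<times> 'e \<times> complex \<Rightarrow> 'x \<times> 'e \<times> complex \<Rightarrow> complex"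
    where "r p q = k (fst p) (fst q) * cinner (fst (snd q)) (fst (snd p))
      - snd (snd q) * cnj (snd (snd p)) * (k (fst p) (fst q) - k (fst p) z * k z (fst q) / k z z)" for p q
  \<comment> \<open>\<open>k z x\<close> is the inner product of k_x with k_z, and \<open>w\<close>
    is the norm of k_z: \<open>l\<close> is the coefficient of the prescribed image along the unit
    vector k_z / w.\<close>
  define l :: "'x \<times> 'e \<times> complex \<Rightarrow> complex" where "l q = snd (snd q) * k z (fst q) / w" for q
  have leech_eq: "leech p q = r p q - l q * cnj (l p)" for p q
    using w by (simp add: leech_def r_def l_def ck field_simps)
  have Re_leech: "Re (bform leech c c) = Re (bform r c c) - (cmod (lsum l c))\<^sup>2" for c
  proof -
    have "bform leech c c = bform r c c - lsum l c * cnj (lsum l c)"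
      unfolding bform_rank_one[symmetric] bform_diff_kernel[symmetric] leech_eq ..
    then show ?thesis
      by (simp add: complex_norm_square[symmetric])
  qed
  \<comment> \<open>The 0 is a placeholder for t: the bracket in \<open>r\<close> vanishes when
    either point is \<open>z\<close>, so \<open>r\<close> does not see it.\<close>
  define z0 where "z0 = (z, e, 0 :: complex)"
  have r: "psd_on (insert z0 S) r"
  proof -
    \<comment> \<open>\<open>r\<close> is \<open>leech\<close> times the Pick factor, which vanishes
      at \<open>z\<close>, plus a weighted Gram kernel of the vectors e.\<close>
    have "psd_on S (\<lambda>p q. leech p q * pick z (fst p) (fst q))"
      by (rule psd_on_pick_mult[OF S])
    then have "psd_on (insert z0 S) (\<lambda>p q. leech p q * pick z (fst p) (fst q))"
      by (rule psd_on_insert_null) (simp_all add: pick_null z0_def)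
    from psd_on_add[OF this psd_on_rank_one_mult[OF psd_on_gram,
          of _ "\<lambda>p. k (fst p) z / w" "\<lambda>p. fst (snd p)"]]
    show ?thesis
    proof (rule psd_on_cong)
      fix p q :: "'x \<times> 'e \<times> complex"
      show "leech p q * pick z (fst p) (fst q) + k (fst p) z / w * cnj (k (fst q) z / w) *
          cinner (fst (snd q)) (fst (snd p)) = r p q"
        using w(1) k_nonzero[of "fst p" "fst q"] unfolding leech_def pick_def r_def w(2)
        by (simp add: ck field_simps)
    qed
  qed
  interpret semi_inner "{c :: (('x \<times> 'e \<times> complex) \<times> complex) list. fst ` set c \<subseteq> insert z0 S}" "(@)" lsc "bform r"
    by (rule psd_on_semi_inner[OF r])
  have "\<exists>\<tau>. \<forall>\<alpha>. \<forall>u\<in>{c. fst ` set c \<subseteq> S}.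
      cmod (\<alpha> * \<tau> + lsum l u) \<le> sqrt (Q (lsc \<alpha> [(z0, 1)] @ u))"
  proof (rule functional_extension)
    show "cmod (lsum l c) \<le> sqrt (Q c)" if "c \<in> {c. fst ` set c \<subseteq> S}" for c
      using psd_on_nonneg[OF S, of c] that by (intro real_le_rsqrt) (simp add: Re_leech Q_def)
    show "{c. fst ` set c \<subseteq> S} \<noteq> {}"
      by (auto intro!: exI[of _ "[]"])
  qed auto
  then obtain \<tau> where \<tau>: "\<And>\<alpha> u. fst ` set u \<subseteq> S \<Longrightarrow>
      cmod (\<alpha> * \<tau> + lsum l u) \<le> sqrt (Q (lsc \<alpha> [(z0, 1)] @ u))"
    by blast
  \<comment> \<open>A triple over \<open>z\<close> with last entry t has \<open>l\<close> equal to t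
    k(z,z) / w = t w, which must be \<tau>.\<close>
  define z1 where "z1 = (z, e, \<tau> / w)"
  have l_z1: "l z1 = \<tau>"
    using w by (simp add: l_def z1_def)
  have r_z1: "r z1 = r z0" "r p z1 = r p z0" for p
    using k_nonzero[of z z] by (simp_all add: r_def z0_def z1_def fun_eq_iff)
  have "psd_on (insert z1 S) leech"
  proof (rule psd_onI)
    fix c :: "(('x \<times> 'e \<times> complex) \<times> complex) list"
    assume "fst ` set c \<subseteq> insert z1 S"
    from lsum_split[OF this] obtain \<alpha> u
      where u: "fst ` set u \<subseteq> S" and c: "\<And>f. lsum f c = \<alpha> * f z1 + lsum f u"
      by (elim exE conjE) (rule that, assumption, erule spec)
    let ?c = "lsc \<alpha> [(z0, 1)] @ u"
    have c0: "lsum f ?c = \<alpha> * f z0 + lsum f u" for f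
      by (simp add: scaleC_complex)
    have "bform r c c = bform r ?c ?c"
      unfolding bform_lsum c c0 by (simp add: r_z1)
    moreover have "lsum l c = \<alpha> * \<tau> + lsum l u"
      by (simp add: c l_z1)
    moreover have "(cmod (\<alpha> * \<tau> + lsum l u))\<^sup>2 \<le> Q ?c"
      using \<tau>[OF u, of \<alpha>] by (intro sqrt_ge_absD) simp
    ultimately show "0 \<le> Re (bform leech c c)"
      by (simp add: Re_leech Q_def)
  qed (rule leech_commute)
  then show ?thesis
    unfolding z1_def by blast
qed

text \<open>Positivity is tested on finite lists, so it passes to unions of chains; a maximal set
  already contains the triple that \<open>leech_step\<close> would add.\<close>

lemma leech_maximal:
  assumes S: "psd_on S (leech :: 'x \<times> 'e::chilbert_space \<times> complex \<Rightarrow> _)"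
  shows "\<exists>M. S \<subseteq> M \<and> psd_on M leech \<and> (\<forall>x e. \<exists>t. (x, e, t) \<in> M)"
proof -
  let ?A = "{M. S \<subseteq> M \<and> psd_on M (leech :: 'x \<times> 'e \<times> complex \<Rightarrow> _)}"
  have "\<exists>M\<in>?A. \<forall>X\<in>?A. M \<subseteq> X \<longrightarrow> X = M"
  proof (rule subset_Zorn_nonempty)
    show "?A \<noteq> {}"
      using S by blast
    fix \<C> assume \<C>: "\<C> \<noteq> {}" "subset.chain ?A \<C>"
    then have sub: "\<C> \<subseteq> ?A"
      by (simp add: subset_chain_def)
    have "psd_on (\<Union>\<C>) (leech :: 'x \<times> 'e \<times> complex \<Rightarrow> _)"
    proof (rule psd_onI)
      fix c :: "(('x \<times> 'e \<times> complex) \<times> complex) list"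
      assume "fst ` set c \<subseteq> \<Union>\<C>"
      then obtain M where "M \<in> \<C>" "fst ` set c \<subseteq> M"
        using finite_subset_Union_chain[of "fst ` set c" \<C> ?A] \<C> by auto
      then show "0 \<le> Re (bform leech c c)"
        using sub psd_on_nonneg by blast
    qed (rule leech_commute)
    then show "\<Union>\<C> \<in> ?A"
      using \<C>(1) sub by blast
  qed
  then obtain M where "M \<in> ?A" and max': "\<forall>X\<in>?A. M \<subseteq> X \<longrightarrow> X = M"
    by (elim bexE)
  then have M: "S \<subseteq> M" "psd_on M leech"
    by simp_all
  have max: "X = M" if "S \<subseteq> X" "psd_on X leech" "M \<subseteq> X" for X
    by (rule max'[rule_format]) (use that in simp_all)
  have "\<exists>t. (x, e, t) \<in> M" for x e
  proof -
    obtain t where "psd_on (insert (x, e, t) M) leech"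
      using leech_step[OF M(2)] by blast
    then have "insert (x, e, t) M = M"
      using M(1) by (intro max) auto
    then show ?thesis
      by blast
  qed
  then show ?thesis
    using M by blast
qed

text \<open>Over a single point x the form is k(x,x) times the difference of two squares. Relations
  among the vectors are thus inherited by the scalars: three triples cover uniqueness, additivity,
  homogeneity and the bound of e \<mapsto> t.\<close>

lemma leech_linear:
  assumes M: "psd_on M (leech :: 'x \<times> 'e::chilbert_space \<times> complex \<Rightarrow> _)"
    and in_M: "(x, e1, t1) \<in> M" "(x, e2, t2) \<in> M" "(x, e3, t3) \<in> M"
  shows "cmod (z1 * t1 + z2 * t2 + z3 * t3) \<le> norm (z1 *\<^sub>C e1 + z2 *\<^sub>C e2 + z3 *\<^sub>C e3)"
proof -
  let ?v = "z1 *\<^sub>C e1 + z2 *\<^sub>C e2 + z3 *\<^sub>C e3" and ?t = "z1 * t1 + z2 * t2 + z3 * t3"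
  let ?c = "[((x, e1, t1), z1), ((x, e2, t2), z2), ((x, e3, t3), z3)]"
  have "bform leech ?c ?c = k x x * (cinner ?v ?v - ?t * cnj ?t)"
    unfolding bform_leech
    by (simp add: bform_def cinner_add_left cinner_add_right cinner_scaleC_left cinner_scaleC_right
        cinner_complex scaleC_complex algebra_simps)
  also have "cinner ?v ?v - ?t * cnj ?t = of_real ((norm ?v)\<^sup>2 - (cmod ?t)\<^sup>2)"
    by (simp only: cinner_self complex_norm_square[symmetric] of_real_diff)
  finally have "Re (bform leech ?c ?c) = Re (k x x) * ((norm ?v)\<^sup>2 - (cmod ?t)\<^sup>2)"
    by simp
  moreover have "0 \<le> Re (bform leech ?c ?c)"
    by (rule psd_on_nonneg[OF M]) (use in_M in auto)
  ultimately have "(cmod ?t)\<^sup>2 \<le> (norm ?v)\<^sup>2"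
    using k_pos(1)[of x] by (simp add: zero_le_mult_iff)
  then show ?thesis
    by (rule power2_le_imp_le) simp
qed

text \<open>In a maximal set e \<mapsto> t is a contractive functional at every point, and its Riesz
  vector is \<Phi>(x).\<close>

theorem leech_factorization:
  fixes S :: "('x \<times> 'e::chilbert_space \<times> complex) set"
  assumes S: "psd_on S leech"
  obtains \<Phi> :: "'x \<Rightarrow> 'e" where "contractive_column_multiplier k \<Phi>"
    and "\<And>x e t. (x, e, t) \<in> S \<Longrightarrow> t = cinner e (\<Phi> x)"
proof -
  obtain M where M: "S \<subseteq> M" "psd_on M leech" and "\<forall>x e. \<exists>t. (x, e, t) \<in> M"
    using leech_maximal[OF S] by blast
  then obtain T where T: "\<And>x e. (x, e, T x e) \<in> M"
    by metis
  have T_unique: "t = T x e" if "(x, e, t) \<in> M" for x e t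
    using leech_linear[OF M(2) that T[of x e] T[of x e], of 1 "-1" 0] by (simp add: scaleC_minus_one)
  have "\<exists>w. \<forall>e. T x e = cinner e w" for x
  proof (rule riesz_representation)
    show "T x (v + w) = T x v + T x w" for v w
      using leech_linear[OF M(2) T[of x v] T[of x w] T[of x "v + w"], of 1 1 "-1"]
      by (simp add: scaleC_minus_one)
    show "T x (z *\<^sub>C v) = z * T x v" for z v
      using leech_linear[OF M(2) T[of x v] T[of x "z *\<^sub>C v"] T[of x v], of z "-1" 0]
      by (simp add: scaleC_minus_one)
    show "cmod (T x v) \<le> 1 * norm v" for v
      using leech_linear[OF M(2) T[of x v] T[of x v] T[of x v], of 1 0 0] by simp
  qed
  then obtain \<Phi> where \<Phi>: "\<And>x e. T x e = cinner e (\<Phi> x)"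
    by metis
  have in_M: "(x, e, cinner e (\<Phi> x)) \<in> M" for x e
    using T[of x e] by (simp add: \<Phi>)
  interpret H: positive_kernel k "TYPE(complex)"
    by (rule positive_kernel)
  interpret HE: positive_kernel k "TYPE('e)"
    by (rule positive_kernel)
  have "(\<lambda>x. f x *\<^sub>C \<Phi> x) \<in> elems (rkhs k) \<and> fnorm (rkhs k) (\<lambda>x. f x *\<^sub>C \<Phi> x) \<le> fnorm (rkhs k) f"
    if f: "f \<in> elems (rkhs k)" for f :: "'x \<Rightarrow> complex"
  proof -
    have bd: "0 \<le> fnorm (rkhs k) f"
      "\<And>c. cmod (pairing f c) \<le> fnorm (rkhs k) f * sqrt (Re (bform k c c))"
      using H.rkhs_char[of f "fnorm (rkhs k) f"] f by auto
    have "cmod (pairing (\<lambda>x. f x *\<^sub>C \<Phi> x) c) \<le> fnorm (rkhs k) f * sqrt (Re (bform k c c))" for c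
    proof -
      \<comment> \<open>The image of \<open>c\<close> under the adjoint of multiplication by \<Phi>,
        so pairing f \<Phi> with \<open>c\<close> is pairing f with \<open>?d\<close>.\<close>
      let ?d = "map (\<lambda>a. (fst a, cinner (snd a) (\<Phi> (fst a)))) c"
      let ?p = "map (\<lambda>a. ((fst a, snd a, cinner (snd a) (\<Phi> (fst a))), 1 :: complex)) c"
      have "cinner (\<Phi> x) v = cnj (cinner v (\<Phi> x))" for x v
        by (rule cinner_commute)
      then have "pairing (\<lambda>x. f x *\<^sub>C \<Phi> x) c = pairing f ?d"
        by (induction c) (simp_all add: cinner_complex cinner_scaleC_left)
      moreover have "0 \<le> Re (bform leech ?p ?p)"
        by (rule psd_on_nonneg[OF M(2)]) (use in_M in auto)
      then have "Re (bform k ?d ?d) \<le> Re (bform k c c)"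
        unfolding bform_leech by (simp add: o_def)
      then have "fnorm (rkhs k) f * sqrt (Re (bform k ?d ?d)) \<le> fnorm (rkhs k) f * sqrt (Re (bform k c c))"
        using bd(1) by (intro mult_left_mono) auto
      ultimately show ?thesis
        using bd(2)[of ?d] by simp
    qed
    then show ?thesis
      using HE.rkhs_char bd(1) by blast
  qed
  then have "contractive_column_multiplier k \<Phi>"
    by (simp add: contractive_column_multiplier_def)
  then show thesis
    using that M(1) T_unique \<Phi> by blast
qed

end

subsection \<open>Beurling pairs\<close>

lemma bounded_clinear_riesz:
  assumes "bounded_clinear (T :: 'e::chilbert_space \<Rightarrow> complex)"
  shows "\<exists>w. \<forall>v. T v = cinner v w"
proof -
  obtain C where "\<And>v. norm (T v) \<le> C * norm v"
    using assms by (auto simp: bounded_clinear_def)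
  moreover have "T (v + w) = T v + T w" "T (z *\<^sub>C v) = z * T v" for v w z
    using assms by (simp_all add: bounded_clinear_def scaleC_complex)
  ultimately show ?thesis
    by (intro riesz_representation)
qed

lemma cadjoint_functional:
  assumes "\<And>v. T v = cinner v (w :: 'e::chilbert_space)"
  shows "cadjoint T z = z *\<^sub>C w"
proof -
  have "cadjoint T = (\<lambda>z. z *\<^sub>C w)"
    unfolding cadjoint_def
  proof (rule the_equality)
    show "\<forall>v z. cinner (T v) z = cinner v (z *\<^sub>C w)"
      by (simp add: assms cinner_complex cinner_scaleC_right)
    fix S assume S: "\<forall>v z. cinner (T v) z = cinner v (S z)"
    show "S = (\<lambda>z. z *\<^sub>C w)"
    proof
      fix z
      let ?d = "S z - z *\<^sub>C w"
      have "cinner ?d (S z) = cinner ?d (z *\<^sub>C w)"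
        using S[rule_format, of ?d z] by (simp add: assms cinner_complex cinner_scaleC_right mult.commute)
      then have "cinner ?d ?d = 0"
        by (simp add: cinner_diff_right)
      then show "S z = z *\<^sub>C w"
        using Re_cinner_self[of ?d] by simp
    qed
  qed
  then show ?thesis
    by simp
qed

text \<open>Cancels one norm in an estimate of the form ||q||^2 <= ||q|| ||d||, allowing q =
  0.\<close>

lemma le_if_le_sqrt_mult:
  assumes "a \<le> sqrt a * sqrt b" "0 \<le> a" "0 \<le> b"
  shows "a \<le> b"
proof (cases "a = 0")
  case False
  then have "sqrt a * sqrt a \<le> sqrt a * sqrt b" "0 < sqrt a"
    using assms by auto
  then have "sqrt a \<le> sqrt b"
    by (metis mult_le_cancel_left_pos)
  then show ?thesis
    by simp
qed (use assms in simp)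

text \<open>\<alpha> and \<beta> are the Riesz vectors of the rows, that is,
  \<open>cadjoint (A x) 1\<close> and \<open>cadjoint (B x) 1\<close>.\<close>

locale beurling = cnp u k for u :: "'x \<Rightarrow> 'i \<Rightarrow> complex" and k +
  fixes h :: "'x \<Rightarrow> complex" and A B :: "'x \<Rightarrow> 'e::chilbert_space \<Rightarrow> complex" and \<alpha> \<beta> :: "'x \<Rightarrow> 'e"
  assumes beurling: "beurling_pair k h A B"
    and A_eq: "A x v = cinner v (\<alpha> x)"
    and B_eq: "B x v = cinner v (\<beta> x)"
begin

sublocale H: positive_kernel k "TYPE(complex)"
  by (rule positive_kernel)

sublocale HE: positive_kernel k "TYPE('e)"
  by (rule positive_kernel)

abbreviation SH :: "('x, complex) fspace" where "SH \<equiv> rkhs k"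
abbreviation SE :: "('x, 'e) fspace" where "SE \<equiv> rkhs k"

sublocale SH: kernel_space SH k
  by (rule H.rkhs_kernel_space)

sublocale SE: kernel_space SE k
  by (rule HE.rkhs_kernel_space)

definition V :: "('x \<Rightarrow> 'e) \<Rightarrow> ('x \<Rightarrow> complex) \<times> ('x \<Rightarrow> complex)"
  where "V F = (\<lambda>x. A x (F x), \<lambda>x. B x (F x))"

lemma rows: "row_multiplier k A" "row_multiplier k B"
  and partial_isometry_V: "partial_isometry SE SH V"
  and range_V: "V ` elems SE = mult_graph SH h"
  using beurling by (auto simp: beurling_pair_def Let_def V_def[abs_def])

lemma row_gram_A: "row_gram A x y = cinner (\<alpha> y) (\<alpha> x)"
  using cadjoint_functional[of "A y", OF A_eq, of 1] by (simp add: row_gram_def A_eq)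

lemma row_gram_B: "row_gram B x y = cinner (\<beta> y) (\<beta> x)"
  using cadjoint_functional[of "B y", OF B_eq, of 1] by (simp add: row_gram_def B_eq)

lemma V_zero_iff: "V F = (\<lambda>x. 0, \<lambda>x. 0) \<longleftrightarrow> (\<forall>x. cinner (F x) (\<alpha> x) = 0 \<and> cinner (F x) (\<beta> x) = 0)"
  by (auto simp: V_def A_eq B_eq fun_eq_iff)

lemma norm_V:
  assumes "F \<in> elems SE" "\<And>G. G \<in> elems SE \<Longrightarrow> V G = (\<lambda>x. 0, \<lambda>x. 0) \<Longrightarrow> ip SE F G = 0"
  shows "sum_norm SH (V F) = fnorm SE F"
  using partial_isometry_V assms by (simp add: partial_isometry_def)

text \<open>Any preimage loses its component in ker V without changing its image, and V is isometric
  on what remains.\<close>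

lemma preimage_orthogonal:
  assumes "P \<in> mult_graph SH h"
  obtains F where "F \<in> elems SE" "V F = P" "fnorm SE F = sum_norm SH P"
proof -
  have "P \<in> V ` elems SE"
    using assms by (simp only: range_V)
  then obtain F where F: "F \<in> elems SE" "V F = P"
    by blast
  let ?N = "{G \<in> elems SE. V G = (\<lambda>x. 0, \<lambda>x. 0)}"
  have "\<exists>P\<in>?N. \<forall>G\<in>?N. ip SE F G = ip SE P G"
  proof (rule SE.projection)
    fix s :: "nat \<Rightarrow> 'x \<Rightarrow> 'e" and P
    assume s: "\<And>n. s n \<in> ?N" and P: "P \<in> elems SE"
      and lim: "\<And>e. e \<in> elems SE \<Longrightarrow> (\<lambda>n. ip SE (s n) e) \<longlonglongrightarrow> ip SE P e"
    have "(\<lambda>n. cinner (s n x) v) \<longlonglongrightarrow> cinner (P x) v" for x v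
      using lim[OF SE.kfun_in[of "[(x, v)]"]] s P by (simp add: SE.ip_kfun)
    \<comment> \<open>ker V is cut out by inner products with \<alpha>(x) and \<beta>(x) at each
      point, so it is weakly closed.\<close>
    from LIMSEQ_unique[OF this[of _ "\<alpha> _"]] LIMSEQ_unique[OF this[of _ "\<beta> _"]]
    have "cinner (P x) (\<alpha> x) = 0 \<and> cinner (P x) (\<beta> x) = 0" for x
      using s by (simp add: V_zero_iff)
    then show "P \<in> ?N"
      using P by (simp add: V_zero_iff)
  qed (use F SE.zero_in SE.add_closed SE.sc_closed in
      \<open>auto simp: V_zero_iff cinner_add_left cinner_scaleC_left\<close>)
  then obtain P0 where P0: "P0 \<in> elems SE" "V P0 = (\<lambda>x. 0, \<lambda>x. 0)"
    and orth: "\<And>G. G \<in> ?N \<Longrightarrow> ip SE F G = ip SE P0 G"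
    by blast
  let ?F = "SE.sub F P0"
  have "V ?F = V F"
    using P0(2) by (simp add: V_zero_iff) (simp add: V_def SE.sub_eq A_eq B_eq cinner_diff_left)
  moreover have "ip SE ?F G = 0" if "G \<in> elems SE" "V G = (\<lambda>x. 0, \<lambda>x. 0)" for G
    using orth[of G] that F(1) P0(1) by (simp add: SE.ip_sub_left)
  ultimately show thesis
    using that[of ?F] norm_V[of ?F] F P0(1) SE.sub_closed by simp
qed

text \<open>Multiplication by B is a contraction, being a component of V. The function
  \<open>g\<close> below is the image under its adjoint of the combination in \<open>c\<close>; it
  is orthogonal to ker V, so V is isometric at it.\<close>

lemma psd_one_minus_B: "psd_on UNIV (\<lambda>x y. (1 - row_gram B x y) * k x y)"
proof (rule psd_onI)
  show "(1 - row_gram B x y) * k x y = cnj ((1 - row_gram B y x) * k y x)" for x y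
    using k_commute[of x y] cinner_commute[of "\<beta> y" "\<beta> x"] by (simp add: row_gram_B)
  fix c :: "('x \<times> complex) list"
  let ?d = "map (\<lambda>a. (fst a, snd a *\<^sub>C \<beta> (fst a))) c"
  define g where "g = kfun k ?d"
  have g: "g \<in> elems SE"
    unfolding g_def by (rule SE.kfun_in)
  have Qg: "fnorm SE g = sqrt (Re (bform k ?d ?d))"
    by (simp add: g_def SE.fnorm_eq SE.Q_kfun)
  have pairing_d: "pairing G ?d = pairing (\<lambda>x. B x (G x)) c" for G
    by (induction c) (auto simp: cinner_complex cinner_scaleC_right B_eq mult.commute)
  have "ip SE g G = 0" if "G \<in> elems SE" "V G = (\<lambda>x. 0, \<lambda>x. 0)" for G
  proof -
    have "(\<lambda>x. B x (G x)) = (\<lambda>x. 0)"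
      using that(2) by (simp add: V_def)
    then have "ip SE G g = 0"
      using that(1) by (simp add: g_def SE.ip_kfun pairing_d)
    then show ?thesis
      using SE.ip_commute[OF g that(1)] by simp
  qed
  then have "sum_norm SH (V g) = fnorm SE g"
    using g by (intro norm_V)
  moreover have "fnorm SH (\<lambda>x. B x (g x)) \<le> sum_norm SH (V g)"
    unfolding sum_norm_def V_def snd_conv fst_conv by (rule real_sqrt_sum_squares_ge2)
  moreover have "(\<lambda>x. B x (g x)) \<in> elems SH"
    using rows(2) g by (simp add: row_multiplier_def Let_def)
  ultimately have "cmod (pairing (\<lambda>x. B x (g x)) c) \<le> fnorm SE g * sqrt (Re (bform k c c))"
    using SH.pairing_bound[of "\<lambda>x. B x (g x)" c] H.pos[of c]
    by (smt (verit) mult_right_mono real_sqrt_ge_zero)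
  moreover have "pairing (\<lambda>x. B x (g x)) c = bform k ?d ?d"
    by (simp add: bform_def g_def pairing_d)
  ultimately have "Re (bform k ?d ?d) \<le> sqrt (Re (bform k ?d ?d)) * sqrt (Re (bform k c c))"
    using complex_Re_le_cmod[of "bform k ?d ?d"] Qg by simp
  then have "Re (bform k ?d ?d) \<le> Re (bform k c c)"
    by (rule le_if_le_sqrt_mult) (rule HE.pos H.pos)+
  moreover have "bform k ?d ?d = bform (\<lambda>x y. k x y * row_gram B x y) c c"
    using bform_expand[of k "\<lambda>x. x" \<beta> c c] by (simp add: row_gram_B)
  moreover have "bform (\<lambda>x y. (1 - row_gram B x y) * k x y) c c
      = bform k c c - bform (\<lambda>x y. k x y * row_gram B x y) c c"
    unfolding bform_diff_kernel[symmetric] by (rule bform_cong) (simp add: algebra_simps)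
  ultimately show "0 \<le> Re (bform (\<lambda>x y. (1 - row_gram B x y) * k x y) c c)"
    by simp
qed

context
  fixes a b
  assumes representing: "representing_pair k h a b"
begin

text \<open>A \<Phi> = a and B \<Phi> = b in conjugated form: the inner product of \<alpha>(x) with
  \<Phi>(x) is \<open>cnj (a x)\<close>, and likewise for \<beta> and b.\<close>

definition prescribed :: "('x \<times> 'e \<times> complex) set"
  where "prescribed = range (\<lambda>x. (x, \<alpha> x, cnj (a x))) \<union> range (\<lambda>x. (x, \<beta> x, cnj (b x)))"

text \<open>With q the prescribed image of the combination \<open>?d\<close> and F the short lift of
  (aq, bq), the pairing of F with \<open>?d\<close> is ||q||^2, while F is no longer than q. Hence
  ||q||^2 <= ||q|| ||d||.\<close>

lemma psd_prescribed: "psd_on prescribed leech"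
proof (rule psd_onI)
  fix c :: "(('x \<times> 'e \<times> complex) \<times> complex) list"
  assume c: "fst ` set c \<subseteq> prescribed"
  let ?d = "map (\<lambda>a. (fst (fst a), snd a *\<^sub>C fst (snd (fst a)))) c"
  let ?e = "map (\<lambda>a. (fst (fst a), snd a *\<^sub>C snd (snd (fst a)))) c"
  define q where "q = kfun k ?e"
  have q: "q \<in> elems SH"
    unfolding q_def by (rule SH.kfun_in)
  let ?P = "(\<lambda>x. a x * q x, \<lambda>x. b x * q x)"
  have rep: "a \<in> Mult SH" "b \<in> Mult SH" "\<And>x. b x = a x * h x"
    and le: "\<forall>f\<in>elems SH. sum_norm SH (\<lambda>x. a x * f x, \<lambda>x. b x * f x) \<le> fnorm SH f"
    using representing[unfolded representing_pair_def Let_def] by blast+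
  \<comment> \<open>Since b = a h, multiplying a q by h gives b q, which again lies in the space:
    (aq, bq) is a point of the graph.\<close>
  have "(\<lambda>x. a x * q x) \<in> mult_dom SH h" "snd ?P = (\<lambda>x. h x * (a x * q x))"
    using rep(1-3) q by (auto simp: mult_dom_def Mult_def mult_ac)
  then have "?P \<in> mult_graph SH h"
    by (auto simp: mult_graph_def)
  then obtain F where F: "F \<in> elems SE" "V F = ?P" "fnorm SE F = sum_norm SH ?P"
    by (rule preimage_orthogonal)
  have V_F: "cinner (F x) (\<alpha> x) = a x * q x" "cinner (F x) (\<beta> x) = b x * q x" for x
    using F(2) by (auto simp: V_def A_eq B_eq dest: fun_cong)
  have F_prescribed: "cinner (F (fst p)) (fst (snd p)) = cnj (snd (snd p)) * q (fst p)"
    if "p \<in> prescribed" for p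
    using that V_F by (auto simp: prescribed_def)
  have "pairing F ?d = pairing q ?e"
    using c
  proof (induction c)
    case (Cons p c)
    then show ?case
      using F_prescribed[of "fst p"] by (simp add: cinner_complex cinner_scaleC_right scaleC_complex)
  qed simp
  also have "\<dots> = bform k ?e ?e"
    by (simp add: bform_def q_def)
  finally have eq: "pairing F ?d = bform k ?e ?e" .
  have "Re (bform k ?e ?e) \<le> cmod (pairing F ?d)"
    unfolding eq by (rule complex_Re_le_cmod)
  also have "\<dots> \<le> fnorm SE F * sqrt (Re (bform k ?d ?d))"
    by (rule SE.pairing_bound[OF F(1)])
  also have "\<dots> \<le> fnorm SH q * sqrt (Re (bform k ?d ?d))"
    using F(3) le q HE.pos by (intro mult_right_mono) auto
  also have "fnorm SH q = sqrt (Re (bform k ?e ?e))"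
    by (simp add: q_def SH.fnorm_eq SH.Q_kfun)
  finally have "Re (bform k ?e ?e) \<le> Re (bform k ?d ?d)"
    by (rule le_if_le_sqrt_mult) (rule HE.pos H.pos)+
  then show "0 \<le> Re (bform leech c c)"
    by (simp add: bform_leech)
qed (rule leech_commute)

lemma factorization:
  "\<exists>\<Phi> :: 'x \<Rightarrow> 'e. contractive_column_multiplier k \<Phi> \<and>
    (\<forall>x. a x = A x (\<Phi> x)) \<and> (\<forall>x. b x = B x (\<Phi> x))"
proof -
  obtain \<Phi> :: "'x \<Rightarrow> 'e" where \<Phi>: "contractive_column_multiplier k \<Phi>"
    and eq: "\<And>x e t. (x, e, t) \<in> prescribed \<Longrightarrow> t = cinner e (\<Phi> x)"
    using leech_factorization[OF psd_prescribed] by blast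
  have "cnj (a x) = cinner (\<alpha> x) (\<Phi> x)" "cnj (b x) = cinner (\<beta> x) (\<Phi> x)" for x
    by (auto intro!: eq simp: prescribed_def)
  then have "a x = A x (\<Phi> x)" "b x = B x (\<Phi> x)" for x
    unfolding A_eq B_eq cinner_commute[of "\<Phi> x"] by (metis complex_cnj_cnj)+
  then show ?thesis
    using \<Phi> by blast
qed

text \<open>On the triples coming from A, \<open>leech\<close> is the difference of the two
  kernels.\<close>

lemma M_contained: "contractively_contained (M_space k a) (M_space_row k A)"
  unfolding M_space_def M_space_row_def
proof (rule contractively_contained_rkhs)
  show "psd_on UNIV (\<lambda>x y. a x * cnj (a y) * k x y)"
    using psd_on_rank_one_mult[OF psd_on_k_mult[OF psd_on_one], of UNIV a "\<lambda>x. x"] by simp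
  have "psd_on (range (\<lambda>x. (x, \<alpha> x, cnj (a x)))) leech"
    by (rule psd_on_subset[OF psd_prescribed]) (auto simp: prescribed_def)
  then have "psd_on UNIV (\<lambda>x y. leech (x, \<alpha> x, cnj (a x)) (y, \<alpha> y, cnj (a y)))"
    by (rule psd_on_pullback)
  then show "psd_on UNIV (\<lambda>x y. row_gram A x y * k x y - a x * cnj (a y) * k x y)"
    by (rule psd_on_cong) (simp add: leech_def row_gram_A algebra_simps)
qed

text \<open>Subtracting from 1 reverses the order, so the difference of the kernels is
  \<open>leech\<close> on the triples coming from B; \<open>psd_one_minus_B\<close> makes the
  smaller kernel positive.\<close>

lemma H_contained: "contractively_contained (H_space_row k B) (H_space k b)"
  unfolding H_space_def H_space_row_def
proof (rule contractively_contained_rkhs[OF psd_one_minus_B])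
  have "psd_on (range (\<lambda>x. (x, \<beta> x, cnj (b x)))) leech"
    by (rule psd_on_subset[OF psd_prescribed]) (auto simp: prescribed_def)
  then have "psd_on UNIV (\<lambda>x y. leech (x, \<beta> x, cnj (b x)) (y, \<beta> y, cnj (b y)))"
    by (rule psd_on_pullback)
  then show "psd_on UNIV (\<lambda>x y. (1 - b x * cnj (b y)) * k x y - (1 - row_gram B x y) * k x y)"
    by (rule psd_on_cong) (simp add: leech_def row_gram_B algebra_simps)
qed

end

end

theorem proposition4p2:
  fixes u :: "'x \<Rightarrow> 'i \<Rightarrow> complex"
    and k :: "'x \<Rightarrow> 'x \<Rightarrow> complex"
    and h :: "'x \<Rightarrow> complex"
    and A B :: "'x \<Rightarrow> 'e::chilbert_space \<Rightarrow> complex"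
  assumes "cnp_kernel u k"
    and "densely_defined_multiplier (rkhs k) h"
    and "beurling_pair k h A B"
  shows "(\<forall>a b. representing_pair k h a b \<longrightarrow>
            (\<exists>\<Phi> :: 'x \<Rightarrow> 'e. contractive_column_multiplier k \<Phi> \<and>
               (\<forall>x. a x = A x (\<Phi> x)) \<and> (\<forall>x. b x = B x (\<Phi> x)))) \<and>
         (\<forall>a b. representing_pair k h a b \<longrightarrow>
            contractively_contained (M_space k a) (M_space_row k A) \<and>
            contractively_contained (H_space_row k B) (H_space k b))"
proof -
  have "bounded_clinear (A x)" "bounded_clinear (B x)" for x
    using assms(3) by (simp_all add: beurling_pair_def row_multiplier_def Let_def)
  then have "\<forall>x. \<exists>w. \<forall>v. A x v = cinner v w" "\<forall>x. \<exists>w. \<forall>v. B x v = cinner v w"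
    using bounded_clinear_riesz by blast+
  then obtain \<alpha> \<beta> where AB: "\<And>x v. A x v = cinner v (\<alpha> x)" "\<And>x v. B x v = cinner v (\<beta> x)"
    by metis
  interpret beurling u k h A B \<alpha> \<beta>
    by unfold_locales (rule assms AB)+
  show ?thesis
    using factorization M_contained H_contained by simp
qed

end
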